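(* Let $p$ be an odd prime. If the $R$-module $M$ is a Bousfield module, then the $R$-action on $M$ extends uniquely to an $A$-action (along $R\subset A$) making $M$ a discrete $A$-module.
   Context: $\mathbb{Z}_{(p)}$ denotes the $p$-local integers. $A$ is the ring of degree zero stable operations in $p$-local complex $K$-theory. Fix $q$ primitive mod $p^2$, $\Psi^q\in A$ the Adams operation, $q_i=q^{(-1)^i\lfloor i/2\rfloor}$, $\Theta_n(X)=\prod_{i=1}^n(X-q_i)$, $\Phi_n=\Theta_n(\Psi^q)$; every element of $A$ is uniquely a convergent sum $\sum_{n\ge0}a_n\Phi_n$ with $a_n\in\mathbb{Z}_{(p)}$, and $A_m=\{\sum_{n\ge m}a_n\Phi_n\}$. An $A$-module $M$ is discrete if each $x\in M$ satisfies $A_nx=0$ for some $n$. Let $R=\mathbb{Z}_{(p)}[\mathbb{Z}_{(p)}^\times]$, writing $\Psi^j$ for $j\in\mathbb{Z}_{(p)}^\times$; mapping $\Psi^j$ to the Adams operation $\Psi^j\in A$ gives $R\subset A$. A Bousfield module is an $R$-module $M$ such that for each $x\in M$: (a) $Rx$ is finitely generated over $\mathbb{Z}_{(p)}$; (b) for each $j\in\mathbb{Z}_{(p)}^\times$, $\Psi^j$ acts on $Rx\otimes\mathbb{Q}$ by a diagonalisable matrix whose eigenvalues are integer powers of $j$; (c) for each $m\ge1$ the action of $\mathbb{Z}_{(p)}^\times$ on $Rx/p^mRx$ factors through $\mathbb{Z}_{(p)}^\times\to(\mathbb{Z}/p^k\mathbb{Z})^\times$ for sufficiently large $k$. *)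

theory Defs
  imports "HOL-Analysis.Analysis" "HOL-Number_Theory.Number_Theory"
begin

definition zloc :: "nat \<Rightarrow> rat set" where
  "zloc p = {x. \<not> int p dvd snd (quotient_of x)}"

definition zloc_units :: "nat \<Rightarrow> rat set" where
  "zloc_units p = {x \<in> zloc p. x \<noteq> 0 \<and> inverse x \<in> zloc p}"

definition grp_ring :: "nat \<Rightarrow> (rat \<Rightarrow> rat) set" where
  "grp_ring p = {r. finite {j. r j \<noteq> 0} \<and> (\<forall>j. r j \<noteq> 0 \<longrightarrow> j \<in> zloc_units p)
                    \<and> (\<forall>j. r j \<in> zloc p)}"

definition gr_add :: "(rat \<Rightarrow> rat) \<Rightarrow> (rat \<Rightarrow> rat) \<Rightarrow> rat \<Rightarrow> rat" where
  "gr_add r s = (\<lambda>j. r j + s j)"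

definition gr_mult :: "(rat \<Rightarrow> rat) \<Rightarrow> (rat \<Rightarrow> rat) \<Rightarrow> rat \<Rightarrow> rat" where
  "gr_mult r s = (\<lambda>j. \<Sum>i\<in>{i. r i \<noteq> 0}. r i * s (j / i))"

definition gr_Psi :: "rat \<Rightarrow> rat \<Rightarrow> rat" where
  "gr_Psi j = (\<lambda>i. if i = j then 1 else 0)"

definition gr_const :: "rat \<Rightarrow> rat \<Rightarrow> rat" where
  "gr_const c = (\<lambda>i. if i = 1 then c else 0)"

definition ring_action ::
  "'r set \<Rightarrow> ('r \<Rightarrow> 'r \<Rightarrow> 'r) \<Rightarrow> ('r \<Rightarrow> 'r \<Rightarrow> 'r) \<Rightarrow> 'r \<Rightarrow> ('r \<Rightarrow> 'm::ab_group_add \<Rightarrow> 'm) \<Rightarrow> bool" where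
  "ring_action S pl mu e act \<longleftrightarrow>
     (\<forall>r\<in>S. \<forall>x y. act r (x + y) = act r x + act r y) \<and>
     (\<forall>r\<in>S. \<forall>s\<in>S. \<forall>x. act (pl r s) x = act r x + act s x) \<and>
     (\<forall>r\<in>S. \<forall>s\<in>S. \<forall>x. act (mu r s) x = act r (act s x)) \<and>
     (\<forall>x. act e x = x)"

definition R_module :: "nat \<Rightarrow> ((rat \<Rightarrow> rat) \<Rightarrow> 'm::ab_group_add \<Rightarrow> 'm) \<Rightarrow> bool" where
  "R_module p act \<longleftrightarrow> ring_action (grp_ring p) gr_add gr_mult (gr_Psi 1) act"

definition zsmul :: "((rat \<Rightarrow> rat) \<Rightarrow> 'm \<Rightarrow> 'm) \<Rightarrow> rat \<Rightarrow> 'm \<Rightarrow> 'm" where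
  "zsmul act c x = act (gr_const c) x"

definition cyclic_sub :: "nat \<Rightarrow> ((rat \<Rightarrow> rat) \<Rightarrow> 'm \<Rightarrow> 'm) \<Rightarrow> 'm \<Rightarrow> 'm set" where
  "cyclic_sub p act x = {act r x | r. r \<in> grp_ring p}"

definition torsion_el :: "((rat \<Rightarrow> rat) \<Rightarrow> 'm::ab_group_add \<Rightarrow> 'm) \<Rightarrow> 'm \<Rightarrow> bool" where
  "torsion_el act y \<longleftrightarrow> (\<exists>N::int. N \<noteq> 0 \<and> zsmul act (of_int N) y = 0)"

definition bous_a :: "nat \<Rightarrow> ((rat \<Rightarrow> rat) \<Rightarrow> 'm::ab_group_add \<Rightarrow> 'm) \<Rightarrow> 'm \<Rightarrow> bool" where
  "bous_a p act x \<longleftrightarrow>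
     (\<exists>G. finite G \<and> G \<subseteq> cyclic_sub p act x \<and>
        cyclic_sub p act x = {\<Sum>g\<in>G. zsmul act (c g) g | c. \<forall>g. c g \<in> zloc p})"

text \<open>(b) Psi^j acts on Rx (x) Q diagonalisably with eigenvalues integer powers of j:
  Rx (x) Q is spanned by eigenvectors (images of elements of Rx, y |-> y (x) 1 having
  the torsion elements as kernel) with eigenvalues j^k, k in Z.\<close>
definition bous_b :: "nat \<Rightarrow> ((rat \<Rightarrow> rat) \<Rightarrow> 'm::ab_group_add \<Rightarrow> 'm) \<Rightarrow> 'm \<Rightarrow> bool" where
  "bous_b p act x \<longleftrightarrow>
     (\<forall>j\<in>zloc_units p. \<forall>y\<in>cyclic_sub p act x.
        \<exists>N::int. \<exists>n::nat. \<exists>ys::nat \<Rightarrow> 'm. \<exists>ks::nat \<Rightarrow> int.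
          N \<noteq> 0 \<and> (\<forall>i<n. ys i \<in> cyclic_sub p act x) \<and>
          (\<forall>i<n. torsion_el act (act (gr_Psi j) (ys i) - zsmul act (j powi ks i) (ys i))) \<and>
          torsion_el act (zsmul act (of_int N) y - (\<Sum>i<n. ys i)))"

text \<open>(c) For each m >= 1 the action of Z_(p)^x on Rx/p^m Rx factors through
  (Z/p^k)^x for some (hence all sufficiently large) k.\<close>
definition bous_c :: "nat \<Rightarrow> ((rat \<Rightarrow> rat) \<Rightarrow> 'm::ab_group_add \<Rightarrow> 'm) \<Rightarrow> 'm \<Rightarrow> bool" where
  "bous_c p act x \<longleftrightarrow>
     (\<forall>m::nat. m \<ge> 1 \<longrightarrow> (\<exists>k::nat.
        \<forall>j\<in>zloc_units p. \<forall>j'\<in>zloc_units p. (j - j') / of_nat (p ^ k) \<in> zloc p \<longrightarrow>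
          (\<forall>y\<in>cyclic_sub p act x. \<exists>z\<in>cyclic_sub p act x.
             act (gr_Psi j) y - act (gr_Psi j') y = zsmul act (of_nat (p ^ m)) z)))"

definition bousfield_module :: "nat \<Rightarrow> ((rat \<Rightarrow> rat) \<Rightarrow> 'm::ab_group_add \<Rightarrow> 'm) \<Rightarrow> bool" where
  "bousfield_module p act \<longleftrightarrow> R_module p act \<and>
     (\<forall>x. bous_a p act x \<and> bous_b p act x \<and> bous_c p act x)"

text \<open>A stable degree-zero operation is recorded by its action on the coefficient
  groups pi_{2k} K = Z_(p), k in Z (a faithful representation; composition becomes
  pointwise multiplication).  Psi^q acts on pi_{2k} by q^k, so Phi_n acts by
  Theta_n(q^k), and the convergent sum  sum_n a_n Phi_n acts by the (pointwise
  eventually finite) sum  sum_n a_n Theta_n(q^k): Theta_n(q^k) = 0 as soon as q^k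
  is among q_1..q_n, so only finitely many terms are nonzero and the sum is the finite
  sum of its nonzero terms.\<close>

definition q_seq :: "int \<Rightarrow> nat \<Rightarrow> rat" where
  "q_seq q i = of_int q powi ((-1) ^ i * \<lfloor>real i / 2\<rfloor>)"

definition Theta :: "int \<Rightarrow> nat \<Rightarrow> rat \<Rightarrow> rat" where
  "Theta q n X = (\<Prod>i=1..n. X - q_seq q i)"

definition Phi_sum :: "int \<Rightarrow> (nat \<Rightarrow> rat) \<Rightarrow> int \<Rightarrow> rat" where
  "Phi_sum q a = (\<lambda>k. \<Sum>n\<in>{n. a n * Theta q n (of_int q powi k) \<noteq> 0}.
                          a n * Theta q n (of_int q powi k))"

definition A_filt :: "nat \<Rightarrow> int \<Rightarrow> nat \<Rightarrow> (int \<Rightarrow> rat) set" where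
  "A_filt p q m = {Phi_sum q a | a. (\<forall>n. a n \<in> zloc p) \<and> (\<forall>n<m. a n = 0)}"

definition A_ring :: "nat \<Rightarrow> int \<Rightarrow> (int \<Rightarrow> rat) set" where
  "A_ring p q = A_filt p q 0"

text \<open>The inclusion R \<subseteq> A, Psi^j |-> Psi^j (acting on pi_{2k} by j^k).\<close>
definition R_to_A :: "(rat \<Rightarrow> rat) \<Rightarrow> int \<Rightarrow> rat" where
  "R_to_A r = (\<lambda>k. \<Sum>j\<in>{j. r j \<noteq> 0}. r j * j powi k)"

definition A_module :: "nat \<Rightarrow> int \<Rightarrow> ((int \<Rightarrow> rat) \<Rightarrow> 'm::ab_group_add \<Rightarrow> 'm) \<Rightarrow> bool" where
  "A_module p q act \<longleftrightarrow>
     ring_action (A_ring p q) (\<lambda>f g k. f k + g k) (\<lambda>f g k. f k * g k) (\<lambda>k. 1) act"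

definition discrete_A_module :: "nat \<Rightarrow> int \<Rightarrow> ((int \<Rightarrow> rat) \<Rightarrow> 'm::ab_group_add \<Rightarrow> 'm) \<Rightarrow> bool" where
  "discrete_A_module p q act \<longleftrightarrow> A_module p q act \<and>
     (\<forall>x. \<exists>n. \<forall>f\<in>A_filt p q n. act f x = 0)"

end

theory Submission
  imports Defs
begin

text \<open>
  For \<open>P \<in> \<int>\<^sub>(\<^sub>p\<^sub>)[X]\<close> let \<open>P(\<Psi>\<^sup>q)\<close> act on the Bousfield module. The key point is that every \<open>x\<close> is killed by
  a product of factors \<open>\<Psi>\<^sup>q - q\<^sup>k\<close> over a finite set of exponents \<open>k\<close>: by (b) such a product maps \<open>x\<close> to a
  torsion element of \<open>Rx\<close>, by (c) a product over enough consecutive exponents maps \<open>Rx\<close> into \<open>p\<^sup>mRx\<close>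
  (modulo \<open>p\<close>, a product over \<open>(p-1)p\<^sup>k\<close> consecutive exponents is \<open>X\<^bsup>(p-1)p^k\<^esup> - 1\<close>), and by (a) no
  nonzero torsion element of \<open>Rx\<close> lies in \<open>p\<^sup>mRx\<close> for \<open>m\<close> large.

  An operation, seen as a function \<open>f\<close> of \<open>k\<close>, then acts on \<open>x\<close> as \<open>P(\<Psi>\<^sup>q)\<close> for any \<open>P\<close> over \<open>\<int>\<^sub>(\<^sub>p\<^sub>)\<close> with
  \<open>P(q\<^sup>k) = f(k)\<close> at these exponents; two choices of \<open>P\<close> differ by a multiple of the killing product.
  For \<open>f(k) = j\<^sup>k\<close> one takes \<open>P\<close> to be \<open>X\<^sup>s\<close> plus a correction divisible by \<open>p\<^sup>m\<close>, where \<open>q\<^sup>s\<close> is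
  \<open>p\<close>-adically close to \<open>j\<close>; by (c) and Krull's intersection theorem \<open>P(\<Psi>\<^sup>q)x = \<Psi>\<^sup>jx\<close>. Uniqueness
  holds because \<open>\<int>\<^sub>(\<^sub>p\<^sub>)[\<Psi>\<^sup>q]\<close> lies in \<open>R\<close> and the tails \<open>A\<^sub>n\<close> act as zero.
\<close>

hide_const (open) up_ring.coeff up_ring.monom module.smult

section \<open>Arithmetic of the $p$-local integers\<close>

locale plocal =
  fixes p :: nat
  assumes prime_p: "prime p"
begin

text \<open>The reduced denominator divides every other denominator of the same fraction, so any
  representation with denominator prime to \<open>p\<close> will do.\<close>

lemma zloc_iff: "x \<in> zloc p \<longleftrightarrow> (\<exists>a b. \<not> int p dvd b \<and> x = of_int a / of_int b)"
proof
  assume "x \<in> zloc p"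
  then show "\<exists>a b. \<not> int p dvd b \<and> x = of_int a / of_int b"
    unfolding zloc_def by (metis mem_Collect_eq prod.exhaust_sel quotient_of_div)
next
  assume "\<exists>a b. \<not> int p dvd b \<and> x = of_int a / of_int b"
  then obtain a b where ab: "\<not> int p dvd b" "x = of_int a / of_int b" by blast
  obtain n d where nd: "quotient_of x = (n, d)" by fastforce
  from ab have b0: "b \<noteq> 0" by auto
  have d0: "d > 0" and cop: "coprime n d"
    using nd quotient_of_denom_pos quotient_of_coprime by auto
  have "of_int a / of_int b = (of_int n / of_int d :: rat)"
    using ab(2) quotient_of_div[OF nd] by simp
  then have "(of_int (a * d) :: rat) = of_int (n * b)"
    using b0 d0 by (simp add: field_simps)
  then have "a * d = n * b" by (metis of_int_eq_iff)
  then have "d dvd b"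
    using cop by (metis coprime_commute coprime_dvd_mult_right_iff dvd_triv_right)
  then show "x \<in> zloc p"
    using ab(1) nd by (auto simp: zloc_def)
qed

lemma zloc_of_int [simp, intro]: "of_int a \<in> zloc p"
proof -
  have "\<not> int p dvd 1" using prime_gt_1_nat[OF prime_p] by simp
  moreover have "of_int a = (of_int a / of_int 1 :: rat)" by simp
  ultimately show ?thesis unfolding zloc_iff by blast
qed

lemma zloc_of_nat [simp, intro]: "of_nat a \<in> zloc p"
  using zloc_of_int[of "int a"] by simp

lemma zloc_0 [simp, intro]: "0 \<in> zloc p" and zloc_1 [simp, intro]: "1 \<in> zloc p"
  using zloc_of_int[of 0] zloc_of_int[of 1] by simp_all

lemma not_dvd_mult: "\<not> int p dvd a \<Longrightarrow> \<not> int p dvd b \<Longrightarrow> \<not> int p dvd a * b"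
  using prime_p by (simp add: prime_dvd_mult_iff)

lemma zloc_add [simp, intro]:
  assumes "x \<in> zloc p" "y \<in> zloc p" shows "x + y \<in> zloc p"
proof -
  obtain a b c d where *: "\<not> int p dvd b" "x = of_int a / of_int b"
    "\<not> int p dvd d" "y = of_int c / of_int d"
    using assms unfolding zloc_iff by blast
  have "b \<noteq> 0" "d \<noteq> 0" using * by auto
  then have "x + y = of_int (a * d + c * b) / of_int (b * d)"
    using * by (simp add: field_simps)
  then show ?thesis unfolding zloc_iff using not_dvd_mult[OF *(1,3)] by blast
qed

lemma zloc_mult [simp, intro]:
  assumes "x \<in> zloc p" "y \<in> zloc p" shows "x * y \<in> zloc p"
proof -
  obtain a b c d where *: "\<not> int p dvd b" "x = of_int a / of_int b"
    "\<not> int p dvd d" "y = of_int c / of_int d"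
    using assms unfolding zloc_iff by blast
  have "x * y = of_int (a * c) / of_int (b * d)"
    using * by simp
  then show ?thesis unfolding zloc_iff using not_dvd_mult[OF *(1,3)] by blast
qed

lemma zloc_uminus [simp, intro]: "x \<in> zloc p \<Longrightarrow> - x \<in> zloc p"
  using zloc_mult[of "-1" x] zloc_of_int[of "-1"] by simp

lemma zloc_diff [simp, intro]: "x \<in> zloc p \<Longrightarrow> y \<in> zloc p \<Longrightarrow> x - y \<in> zloc p"
  using zloc_add[of x "- y"] by simp

lemma zloc_power [simp, intro]: "x \<in> zloc p \<Longrightarrow> x ^ n \<in> zloc p"
  by (induction n) auto

lemma zloc_sum [intro]: "(\<And>i. i \<in> I \<Longrightarrow> f i \<in> zloc p) \<Longrightarrow> (\<Sum>i\<in>I. f i) \<in> zloc p"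
  by (induction I rule: infinite_finite_induct) auto

lemma units_zloc: "u \<in> zloc_units p \<Longrightarrow> u \<in> zloc p"
  and units_nz: "u \<in> zloc_units p \<Longrightarrow> u \<noteq> 0"
  and units_inverse: "u \<in> zloc_units p \<Longrightarrow> inverse u \<in> zloc_units p"
  by (auto simp: zloc_units_def)

lemma units_1 [simp, intro]: "1 \<in> zloc_units p"
  by (simp add: zloc_units_def)

lemma units_mult: "u \<in> zloc_units p \<Longrightarrow> v \<in> zloc_units p \<Longrightarrow> u * v \<in> zloc_units p"
  by (auto simp: zloc_units_def)

lemma units_divide: "u \<in> zloc_units p \<Longrightarrow> v \<in> zloc_units p \<Longrightarrow> u / v \<in> zloc_units p"
  by (simp add: divide_inverse units_mult units_inverse)

lemma units_power: "u \<in> zloc_units p \<Longrightarrow> u ^ n \<in> zloc_units p"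
  by (induction n) (auto intro: units_mult)

lemma units_powi: "u \<in> zloc_units p \<Longrightarrow> u powi k \<in> zloc_units p"
  by (simp add: power_int_def units_power units_inverse)

lemma zloc_divide_unit: "x \<in> zloc p \<Longrightarrow> u \<in> zloc_units p \<Longrightarrow> x / u \<in> zloc p"
  by (simp add: divide_inverse zloc_units_def)

lemma of_int_unit:
  assumes "\<not> int p dvd a" shows "of_int a \<in> zloc_units p"
proof -
  have "inverse (of_int a) = (of_int 1 / of_int a :: rat)" by (simp add: field_simps)
  then have "inverse (of_int a :: rat) \<in> zloc p"
    using assms unfolding zloc_iff by blast
  then show ?thesis using assms by (auto simp: zloc_units_def)
qed

text \<open>Extracting the power of \<open>p\<close> from the numerator gives the
  \<open>p\<close>-adic valuation \<open>e\<close>: the \<open>p\<close>-local integers form a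
  discrete valuation ring with uniformiser \<open>p\<close>.\<close>

lemma zloc_unit_cases:
  assumes "c \<in> zloc p" "c \<noteq> 0"
  obtains e u where "u \<in> zloc_units p" "c = of_nat p ^ e * u"
proof -
  obtain a b where ab: "\<not> int p dvd b" "c = of_int a / of_int b"
    using assms(1) unfolding zloc_iff by blast
  have "a \<noteq> 0" using ab assms by auto
  moreover have "\<not> is_unit (int p)" using prime_p by (auto dest: prime_gt_1_nat)
  ultimately obtain a' where a': "a = int p ^ multiplicity (int p) a * a'" "\<not> int p dvd a'"
    using multiplicity_decompose'[of a "int p"] by metis
  have "c = of_nat p ^ multiplicity (int p) a * (of_int a' / of_int b)"
    using ab a'(1) by (metis of_int_mult of_int_of_nat_eq of_int_power times_divide_eq_right)
  then show thesis
    using that units_divide[OF of_int_unit of_int_unit] a' ab by blast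
qed

lemma p_pos [simp]: "p > 0" and p_neq_0 [simp]: "p \<noteq> 0"
  using prime_gt_0_nat[OF prime_p] by simp_all

lemma p_nz: "(of_nat p :: rat) \<noteq> 0"
  using p_pos by (metis of_nat_eq_0_iff less_numeral_extra(3))

text \<open>A nonzero \<open>c\<close> has a finite valuation \<open>e\<close>, and dividing it by
  \<open>p^(e+1)\<close> would make \<open>1/p\<close> a \<open>p\<close>-local integer.\<close>

lemma p_power_dvd_imp_0:
  assumes "c \<in> zloc p" "\<And>m. c / of_nat p ^ m \<in> zloc p"
  shows "c = 0"
proof (rule ccontr)
  assume "c \<noteq> 0"
  then obtain e u where eu: "u \<in> zloc_units p" "c = of_nat p ^ e * u"
    using zloc_unit_cases assms by metis
  have "c / of_nat p ^ Suc e = u / of_nat p"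
    using eu(2) by simp
  then have "u / of_nat p \<in> zloc p"
    using assms(2)[of "Suc e"] by simp
  then have "inverse u * (u / of_nat p) \<in> zloc p"
    using units_zloc[OF units_inverse[OF eu(1)]] by blast
  moreover have "inverse u * (u / of_nat p) = of_int 1 / of_int (int p)"
    using units_nz[OF eu(1)] by simp
  ultimately have "of_int 1 / of_int (int p) \<in> zloc p" by (simp only:)
  then obtain a b where ab: "\<not> int p dvd b" "of_int 1 / of_int (int p) = (of_int a / of_int b :: rat)"
    unfolding zloc_iff by blast
  then have "(of_int b :: rat) = of_int (a * int p)"
    using p_nz by (auto simp: field_simps)
  then have "b = a * int p" by (metis of_int_eq_iff)
  then show False using ab by auto
qed

lemma zloc_dvd_of_int:
  assumes "int p ^ m dvd a" shows "of_int a / of_nat p ^ m \<in> zloc p"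
proof -
  obtain b where "a = int p ^ m * b" using assms by blast
  then have "of_int a / of_nat p ^ m = (of_int b :: rat)" using p_nz by simp
  then show ?thesis by simp
qed

text \<open>\<open>u^n - v^n\<close> telescopes into multiples of \<open>u - v\<close>; negative
  exponents reduce to this because \<open>1/u - 1/v = -(u - v)/(u v)\<close> with \<open>u v\<close>
  a unit.\<close>

lemma zloc_powi_cong:
  assumes "u \<in> zloc_units p" "v \<in> zloc_units p" "(u - v) / of_nat p ^ m \<in> zloc p"
  shows "(u powi k - v powi k) / of_nat p ^ m \<in> zloc p"
proof -
  have nat_case: "(u ^ n - v ^ n) / of_nat p ^ m \<in> zloc p" if
    "u \<in> zloc_units p" "v \<in> zloc_units p" "(u - v) / of_nat p ^ m \<in> zloc p" for u v n
  proof (induction n)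
    case (Suc n)
    have "u ^ Suc n - v ^ Suc n = u * (u ^ n - v ^ n) + (u - v) * v ^ n"
      by (simp add: algebra_simps)
    then have "(u ^ Suc n - v ^ Suc n) / of_nat p ^ m
        = u * ((u ^ n - v ^ n) / of_nat p ^ m) + (u - v) / of_nat p ^ m * v ^ n"
      by (simp only: add_divide_distrib times_divide_eq_left times_divide_eq_right)
    moreover have "u * ((u ^ n - v ^ n) / of_nat p ^ m) \<in> zloc p"
      "(u - v) / of_nat p ^ m * v ^ n \<in> zloc p"
      using Suc that units_zloc by blast+
    ultimately show ?case by (simp only: zloc_add)
  qed simp
  have inv: "(inverse u - inverse v) / of_nat p ^ m \<in> zloc p"
  proof -
    have "(inverse u - inverse v) / of_nat p ^ m
        = - (inverse u * inverse v * ((u - v) / of_nat p ^ m))"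
      using assms units_nz by (simp add: field_simps)
    then show ?thesis using assms units_zloc units_inverse by (metis zloc_mult zloc_uminus)
  qed
  show ?thesis
    using nat_case[OF assms] nat_case[OF units_inverse[OF assms(1)] units_inverse[OF assms(2)] inv]
    by (simp add: power_int_def)
qed

end

section \<open>Primitive roots modulo powers of \<open>p\<close> and density of the powers of
  \<open>q\<close>\<close>

lemma residue_primroot_prime_square_imp_power:
  fixes p g :: nat
  assumes p: "prime p" "odd p" and g: "residue_primroot (p\<^sup>2) g" and "k > 0"
  shows "residue_primroot (p ^ k) g"
proof -
  have p2: "p > 2" using p prime_ge_2_nat[OF p(1)] by (cases "p = 2") auto
  have bij: "bij_betw (\<lambda>i. g ^ i mod p\<^sup>2) {..<totient (p\<^sup>2)} (totatives (p\<^sup>2))"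
    using residue_primroot_is_generator[OF _ g] p2 one_less_power[of p 2] by simp
  have cop: "coprime p g" using g by (auto simp: residue_primroot_def)
  \<comment> \<open>Every unit modulo \<open>p\<close> lifts to one modulo \<open>p^2\<close>, hence
    is a power of \<open>g\<close>; reducing the exponent modulo the order bounds the number of
    units by \<open>ord p g\<close>.\<close>
  have sub: "totatives p \<subseteq> (\<lambda>i. g ^ i mod p) ` {..<ord p g}"
  proof
    fix a assume a: "a \<in> totatives p"
    then have "a \<in> totatives (p\<^sup>2)"
      using p2 by (auto simp: totatives_def power2_eq_square intro: le_trans[of a p])
    then obtain i where "a = g ^ i mod p\<^sup>2"
      using bij unfolding bij_betw_def by auto
    then have "a mod p = g ^ i mod p"
      by (simp add: mod_mod_cancel)
    moreover have "a < p" using a p2 by (metis totatives_less prime_gt_1_nat p(1))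
    moreover have "g ^ i mod p = g ^ (i mod ord p g) mod p"
      using order_divides_expdiff[OF cop, of i "i mod ord p g"] by (simp add: cong_def)
    moreover have "ord p g > 0" using cop by (simp add: ord_eq_0)
    ultimately have "a = g ^ (i mod ord p g) mod p" "i mod ord p g < ord p g" by simp_all
    then show "a \<in> (\<lambda>i. g ^ i mod p) ` {..<ord p g}"
      by blast
  qed
  have "totient p \<le> ord p g"
    using card_mono[OF _ sub] card_image_le[of "{..<ord p g}" "\<lambda>i. g ^ i mod p"]
    by (simp add: totient_def)
  moreover have "ord p g dvd totient p" using cop by (simp add: order_divides_totient)
  moreover have "totient p > 0" using p2 by simp
  ultimately have "ord p g = totient p" by (simp add: dvd_imp_le le_antisym)
  then have gp: "residue_primroot p g"
    using cop p2 by (simp add: residue_primroot_def)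
  \<comment> \<open>Otherwise the order of \<open>g\<close> modulo \<open>p^2\<close>, which is
    \<open>p (p - 1)\<close>, would divide \<open>p - 1\<close>. This is the criterion for a
    primitive root modulo \<open>p\<close> to stay one modulo all powers.\<close>
  have "[g ^ (p - 1) \<noteq> 1] (mod p\<^sup>2)"
  proof
    assume "[g ^ (p - 1) = 1] (mod p\<^sup>2)"
    then have "ord (p\<^sup>2) g dvd p - 1" using ord_divides by blast
    moreover have "totient (p\<^sup>2) = p * (p - 1)"
      using totient_prime_power[OF p(1), of 2] by simp
    ultimately have "p * (p - 1) dvd p - 1"
      using g by (simp only: residue_primroot_def)
    then have "p * (p - 1) \<le> p - 1" using p2 by (intro dvd_imp_le) auto
    then show False using p2 by simp
  qed
  then show ?thesis using residue_primroot_prime_lift_iff[OF p gp] \<open>k > 0\<close> by blast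
qed

locale primroot = plocal +
  fixes q :: int
  assumes odd_p: "odd p" and q_primroot: "residue_primroot (p\<^sup>2) (nat (q mod int (p\<^sup>2)))"
begin

text \<open>\<open>q\<close> generates the unit group modulo every power of \<open>p\<close>, so its
  powers reach the class of every integer prime to \<open>p\<close>.\<close>

lemma q_powers_mod:
  assumes "k > 0" "\<not> int p dvd a"
  obtains s where "int p ^ k dvd a - q ^ s"
proof -
  \<comment> \<open>The exponent \<open>k + 2\<close> makes \<open>p^2\<close> divide
    \<open>K\<close>, so the residue \<open>g\<close> of \<open>q\<close> modulo \<open>K\<close>
    still has the assumed residue modulo \<open>p^2\<close>.\<close>
  define K where "K = p ^ (k + 2)"
  define g where "g = nat (q mod int K)"
  have p2: "p \<ge> 2" using prime_p by (rule prime_ge_2_nat)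
  have K0: "K > 1" using p2 unfolding K_def by (intro one_less_power) auto
  have g_eq: "int g = q mod int K"
    using K0 by (simp add: g_def)
  have "int (g mod p\<^sup>2) = int (nat (q mod int (p\<^sup>2)) mod p\<^sup>2)"
  proof -
    have "p\<^sup>2 dvd K" unfolding K_def by (rule le_imp_power_dvd) simp
    then have "int (p\<^sup>2) dvd int K" by (simp only: int_dvd_int_iff)
    then have "q mod int K mod int (p\<^sup>2) = q mod int (p\<^sup>2)"
      by (simp only: mod_mod_cancel)
    moreover have "int (nat (q mod int (p\<^sup>2))) = q mod int (p\<^sup>2)"
      using p2 by simp
    ultimately show ?thesis
      by (simp only: of_nat_mod g_eq mod_mod_trivial)
  qed
  then have "[g = nat (q mod int (p\<^sup>2))] (mod p\<^sup>2)"
    by (simp only: of_nat_eq_iff cong_def)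
  then have "residue_primroot (p\<^sup>2) g"
    using q_primroot residue_primroot_cong by blast
  then have "residue_primroot K g"
    using residue_primroot_prime_square_imp_power[OF prime_p odd_p, of g "k + 2"] by (simp add: K_def)
  then have bij: "bij_betw (\<lambda>i. g ^ i mod K) {..<totient K} (totatives K)"
    using residue_primroot_is_generator K0 by blast
  define a' where "a' = nat (a mod int K)"
  have a'_eq: "int a' = a mod int K" using K0 by (simp add: a'_def)
  have "\<not> int p dvd int a'"
  proof -
    have "int p dvd int K" by (simp add: K_def)
    then show ?thesis using assms(2) by (simp add: a'_eq dvd_mod_iff)
  qed
  then have "\<not> p dvd a'" by simp
  then have "coprime a' p"
    using prime_imp_coprime_nat[OF prime_p] by (simp add: coprime_commute)
  then have "coprime a' K" by (simp add: K_def)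
  moreover have "a' < K" unfolding a'_def using K0 by (simp add: nat_less_iff)
  moreover have "a' > 0" using \<open>\<not> p dvd a'\<close> by (intro gr0I) auto
  ultimately have "a' \<in> totatives K" by (auto simp: totatives_def)
  then obtain s where s: "a' = g ^ s mod K" using bij unfolding bij_betw_def by auto
  have "a mod int K = q ^ s mod int K"
    using s by (metis a'_eq g_eq of_nat_mod of_nat_power power_mod)
  then have "int K dvd a - q ^ s" by (simp add: mod_eq_dvd_iff)
  moreover have "int p ^ k dvd int K" by (simp add: K_def le_imp_power_dvd)
  ultimately show thesis using that dvd_trans by blast
qed

lemma q_not_dvd: "\<not> int p dvd q"
proof
  assume q: "int p dvd q"
  have "p dvd nat (q mod int (p\<^sup>2))"
  proof -
    have "int p dvd q mod int (p\<^sup>2)" using q by (simp add: dvd_mod power2_eq_square)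
    moreover have "q mod int (p\<^sup>2) \<ge> 0" using prime_gt_0_nat[OF prime_p] by simp
    ultimately have "int p dvd int (nat (q mod int (p\<^sup>2)))" by simp
    then show ?thesis by (simp only: int_dvd_int_iff)
  qed
  moreover have "coprime (p\<^sup>2) (nat (q mod int (p\<^sup>2)))"
    using q_primroot by (simp add: residue_primroot_def)
  moreover have "p dvd p\<^sup>2" by (simp add: power2_eq_square)
  ultimately have "is_unit p" using coprime_common_divisor by blast
  then show False using prime_p not_prime_unit by blast
qed

lemma q_unit: "of_int q \<in> zloc_units p"
  using of_int_unit q_not_dvd by blast

text \<open>A fraction \<open>a / b\<close> is \<open>p\<close>-adically close to the integer
  \<open>a b'\<close> with \<open>b'\<close> inverse to \<open>b\<close>, and
  \<open>q_powers_mod\<close> applies to that integer.\<close>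

lemma q_density:
  assumes "j \<in> zloc_units p"
  obtains s where "(j - of_int q ^ s) / of_nat p ^ m \<in> zloc p"
proof -
  obtain a b where ab: "\<not> int p dvd b" "j = of_int a / of_int b"
    using units_zloc[OF assms] unfolding zloc_iff by blast
  \<comment> \<open>A numerator divisible by \<open>p\<close> would make
    \<open>1/p = (1/j) (c/b)\<close> \<open>p\<close>-local, and with it all
    \<open>1/p^m\<close>.\<close>
  have "\<not> int p dvd a"
  proof
    assume "int p dvd a"
    then obtain c where "a = int p * c" by blast
    then have "j = of_nat p * (of_int c / of_int b)" using ab by simp
    then have "inverse (of_nat p) = inverse j * (of_int c / of_int b)"
      using units_nz[OF assms] by (simp add: field_simps)
    then have "inverse (of_nat p) \<in> zloc p"
      using assms ab zloc_iff by (metis (no_types) zloc_mult units_inverse units_zloc)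
    then have "1 / of_nat p ^ m \<in> zloc p" for m
      by (metis zloc_power power_inverse inverse_eq_divide)
    then show False using p_power_dvd_imp_0[of 1] by auto
  qed
  have "coprime (int p) b"
    using ab(1) prime_p by (intro prime_imp_coprime) auto
  \<comment> \<open>\<open>Suc m\<close> rather than \<open>m\<close>: also for \<open>m = 0\<close>
    the modulus must be a multiple of \<open>p\<close>, so that \<open>b'\<close> is prime to
    \<open>p\<close>, and \<open>q_powers_mod\<close> needs a positive exponent.\<close>
  then have "coprime b (int p ^ Suc m)"
    by (simp add: coprime_commute)
  then obtain b' where b': "[b * b' = 1] (mod int p ^ Suc m)"
    by (metis cong_solve_coprime_int)
  have "\<not> int p dvd b'"
  proof
    assume "int p dvd b'"
    moreover have "[b * b' = 1] (mod int p)"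
      using b' by (rule cong_dvd_modulus) auto
    ultimately have "int p dvd 1"
      by (metis cong_dvd_iff dvd_mult)
    then show False using prime_p by auto
  qed
  then obtain s where s: "int p ^ Suc m dvd a * b' - q ^ s"
    using q_powers_mod[of "Suc m" "a * b'"] not_dvd_mult[OF \<open>\<not> int p dvd a\<close>] by auto
  have "int p ^ Suc m dvd b * b' - 1" using b' by (simp add: cong_iff_dvd_diff)
  then have "int p ^ Suc m dvd b * (a * b' - q ^ s) - a * (b * b' - 1)"
    using s by (meson dvd_diff dvd_mult)
  then have "int p ^ Suc m dvd a - b * q ^ s" by (simp add: algebra_simps)
  then have "int p ^ m dvd a - b * q ^ s" by (metis dvd_trans le_imp_power_dvd lessI less_imp_le_nat)
  then have "of_int (a - b * q ^ s) / of_nat p ^ m / of_int b \<in> zloc p"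
    using zloc_dvd_of_int zloc_divide_unit of_int_unit ab(1) by blast
  moreover have "of_int (a - b * q ^ s) / of_nat p ^ m / of_int b = (j - of_int q ^ s) / of_nat p ^ m"
  proof -
    have "of_int b \<noteq> (0::rat)" using ab by auto
    then have "of_int (a - b * q ^ s) / of_int b = j - of_int q ^ s"
      using ab by (simp add: diff_divide_distrib)
    then show ?thesis by (metis divide_divide_eq_left mult.commute)
  qed
  ultimately show thesis using that by metis
qed

text \<open>Modulo \<open>p\<close> the order of \<open>q\<close> is exactly \<open>p - 1\<close>,
  so its first \<open>p - 1\<close> powers have distinct residues.\<close>

lemma q_power_diff_unit:
  assumes "s \<noteq> t" "s < p - 1" "t < p - 1"
  shows "\<not> int p dvd q ^ s - q ^ t"
proof
  assume d: "int p dvd q ^ s - q ^ t"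
  define g where "g = nat (q mod int (p\<^sup>2))"
  have "residue_primroot (p ^ 1) g"
    using residue_primroot_prime_square_imp_power[OF prime_p odd_p q_primroot, of 1] by (simp add: g_def)
  then have g: "coprime p g" "ord p g = p - 1"
    using prime_p by (simp_all add: residue_primroot_def totient_prime)
  have "int g mod int p = q mod int p"
    using prime_gt_0_nat[OF prime_p] by (simp add: g_def mod_mod_cancel)
  then have "int (g ^ s mod p) = int (g ^ t mod p)"
    using d by (simp add: of_nat_mod mod_eq_dvd_iff[symmetric]) (metis power_mod)
  then have "g ^ s mod p = g ^ t mod p" by (simp only: of_nat_eq_iff)
  then show False
    using inj_power_mod[OF g(1)] assms g(2) by (auto simp: inj_on_def)
qed

text \<open>If \<open>q\<close> were 1 or -1, then \<open>2 - q^s\<close> would always be 1 or 3 and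
  never divisible by \<open>p^2 >= 9\<close>, against the density of the powers of \<open>q\<close>.
  Needed for the points \<open>q^k\<close> to be distinct.\<close>

lemma abs_q: "\<bar>q\<bar> > 1"
proof (rule ccontr)
  assume "\<not> \<bar>q\<bar> > 1"
  moreover have "q \<noteq> 0" using q_not_dvd by auto
  ultimately have q1: "q = 1 \<or> q = - 1" by linarith
  have p3: "p \<ge> 3" using odd_p prime_ge_2_nat[OF prime_p] by (cases "p = 2") auto
  then have "\<not> int p dvd 2" by (auto dest: zdvd_imp_le)
  then obtain s where s: "int p ^ 2 dvd 2 - q ^ s" using q_powers_mod[of 2 2] by auto
  have "q ^ s = 1 \<or> q ^ s = - 1" using q1 by (cases "even s") auto
  then have "int p ^ 2 \<le> 3" using s zdvd_imp_le by fastforce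
  moreover have "int p ^ 2 \<ge> 3 ^ 2" using p3 by (intro power_mono) auto
  ultimately show False by simp
qed

lemma q_inj_pow: "inj (\<lambda>k. (of_int q :: rat) powi k)"
proof (rule injI)
  fix k l :: int assume eq: "(of_int q :: rat) powi k = of_int q powi l"
  have "\<bar>of_int q :: rat\<bar> > 1" using abs_q by (metis of_int_1_less_iff of_int_abs)
  moreover have "\<bar>of_int q :: rat\<bar> powi k = \<bar>of_int q\<bar> powi l"
    using eq by (metis power_int_abs)
  ultimately show "k = l"
    by (metis power_int_strict_increasing linorder_neqE order_less_irrefl)
qed

end

section \<open>Finitely generated modules over the $p$-local integers\<close>

locale zloc_module = plocal +
  fixes s :: "rat \<Rightarrow> 'm::ab_group_add \<Rightarrow> 'm"
  assumes action: "ring_action (zloc p) (+) (*) 1 s"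
begin

lemma s_add: "c \<in> zloc p \<Longrightarrow> s c (x + y) = s c x + s c y"
  and s_add_left: "c \<in> zloc p \<Longrightarrow> d \<in> zloc p \<Longrightarrow> s (c + d) x = s c x + s d x"
  and s_mult: "c \<in> zloc p \<Longrightarrow> d \<in> zloc p \<Longrightarrow> s (c * d) x = s c (s d x)"
  and s_1 [simp]: "s 1 x = x"
  using action unfolding ring_action_def by blast+

lemma s_zero [simp]: "c \<in> zloc p \<Longrightarrow> s c 0 = 0"
  using s_add[of c 0 0] by simp

lemma s_0 [simp]: "s 0 x = 0"
  using s_add_left[of 0 0 x] by simp

lemma s_minus: "c \<in> zloc p \<Longrightarrow> s c (- x) = - s c x"
  using s_add[of c x "- x"] by (simp add: eq_neg_iff_add_eq_0 add.commute)

lemma s_minus_left: "c \<in> zloc p \<Longrightarrow> s (- c) x = - s c x"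
  using s_add_left[of c "- c" x] by (simp add: eq_neg_iff_add_eq_0 add.commute)

lemma s_diff: "c \<in> zloc p \<Longrightarrow> s c (x - y) = s c x - s c y"
  using s_add[of c x "- y"] by (simp add: s_minus)

lemma s_diff_left: "c \<in> zloc p \<Longrightarrow> d \<in> zloc p \<Longrightarrow> s (c - d) x = s c x - s d x"
  using s_add_left[of c "- d" x] by (simp add: s_minus_left)

lemma s_sum: "c \<in> zloc p \<Longrightarrow> s c (\<Sum>i\<in>I. f i) = (\<Sum>i\<in>I. s c (f i))"
  by (induction I rule: infinite_finite_induct) (simp_all add: s_add)

section \<open>Spans of finite families and their splitting into cyclic summands\<close>

definition gspan :: "'i set \<Rightarrow> ('i \<Rightarrow> 'm) \<Rightarrow> 'm set" where
  "gspan I b = {\<Sum>i\<in>I. s (c i) (b i) | c. \<forall>i. c i \<in> zloc p}"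

lemma gspanI: "(\<And>i. c i \<in> zloc p) \<Longrightarrow> (\<Sum>i\<in>I. s (c i) (b i)) \<in> gspan I b"
  unfolding gspan_def by blast

lemma gspanE:
  assumes "x \<in> gspan I b"
  obtains c where "\<And>i. c i \<in> zloc p" "x = (\<Sum>i\<in>I. s (c i) (b i))"
  using assms unfolding gspan_def by blast

lemma gspan_0: "0 \<in> gspan I b"
  using gspanI[of "\<lambda>_. 0" b I] by simp

lemma gspan_add:
  assumes "x \<in> gspan I b" "y \<in> gspan I b" shows "x + y \<in> gspan I b"
proof -
  obtain c where c: "\<And>i. c i \<in> zloc p" "x = (\<Sum>i\<in>I. s (c i) (b i))"
    using assms(1) by (rule gspanE) blast
  obtain d where d: "\<And>i. d i \<in> zloc p" "y = (\<Sum>i\<in>I. s (d i) (b i))"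
    using assms(2) by (rule gspanE) blast
  have "x + y = (\<Sum>i\<in>I. s (c i + d i) (b i))"
    by (simp add: c d s_add_left sum.distrib)
  then show ?thesis using gspanI[of "\<lambda>i. c i + d i"] c d by simp
qed

lemma gspan_smult:
  assumes "x \<in> gspan I b" "a \<in> zloc p" shows "s a x \<in> gspan I b"
proof -
  obtain c where c: "\<And>i. c i \<in> zloc p" "x = (\<Sum>i\<in>I. s (c i) (b i))"
    using assms(1) by (rule gspanE) blast
  have "s a x = (\<Sum>i\<in>I. s (a * c i) (b i))"
    using assms by (simp add: c s_sum s_mult)
  then show ?thesis using gspanI[of "\<lambda>i. a * c i"] c assms by simp
qed

lemma gspan_diff: "x \<in> gspan I b \<Longrightarrow> y \<in> gspan I b \<Longrightarrow> x - y \<in> gspan I b"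
  using gspan_add[of x I b "s (- 1) y"] gspan_smult[of y I b "- 1"] by (simp add: s_minus_left)

lemma gspan_sum: "(\<And>j. j \<in> J \<Longrightarrow> f j \<in> gspan I b) \<Longrightarrow> (\<Sum>j\<in>J. f j) \<in> gspan I b"
  by (induction J rule: infinite_finite_induct) (auto intro: gspan_0 gspan_add)

lemma gspan_gen:
  assumes "finite I" "i \<in> I" shows "b i \<in> gspan I b"
proof -
  have "(\<Sum>j\<in>I. s (if j = i then 1 else 0) (b j)) = (\<Sum>j\<in>I. if j = i then b i else 0)"
    by (intro sum.cong) auto
  also have "\<dots> = b i" using assms by simp
  finally show ?thesis using gspanI[of "\<lambda>j. if j = i then 1 else 0" b I] by simp
qed

lemma gspan_subset:
  assumes "\<And>i. i \<in> I \<Longrightarrow> b i \<in> gspan J b'" shows "gspan I b \<subseteq> gspan J b'"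
proof
  fix x assume "x \<in> gspan I b"
  then obtain c where "\<And>i. c i \<in> zloc p" "x = (\<Sum>i\<in>I. s (c i) (b i))"
    by (rule gspanE) blast
  then show "x \<in> gspan J b'" using assms by (auto intro!: gspan_sum gspan_smult)
qed

text \<open>The sum of the cyclic submodules generated by the \<open>b i\<close> is direct.
  Generators may be torsion or zero, so this is weaker than linear independence.\<close>

definition indep :: "'i set \<Rightarrow> ('i \<Rightarrow> 'm) \<Rightarrow> bool" where
  "indep I b \<longleftrightarrow> (\<forall>c. (\<forall>i. c i \<in> zloc p) \<longrightarrow> (\<Sum>i\<in>I. s (c i) (b i)) = 0 \<longrightarrow> (\<forall>i\<in>I. s (c i) (b i) = 0))"

lemma indepD:
  "indep I b \<Longrightarrow> (\<And>i. c i \<in> zloc p) \<Longrightarrow> (\<Sum>i\<in>I. s (c i) (b i)) = 0 \<Longrightarrow> i \<in> I \<Longrightarrow> s (c i) (b i) = 0"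
  unfolding indep_def by blast

text \<open>Elimination with a pivot of minimal \<open>p\<close>-adic valuation among the coefficients of all relations.\<close>

lemma indep_generators:
  assumes "finite I"
  shows "\<exists>b'. gspan I b' = gspan I b \<and> indep I b'"
  using assms
proof (induction I arbitrary: b rule: finite_psubset_induct)
  case (psubset I)
  define rel where "rel c \<longleftrightarrow> (\<forall>i. c i \<in> zloc p) \<and> (\<Sum>i\<in>I. s (c i) (b i)) = 0" for c
  \<comment> \<open>\<open>e\<close> is the valuation of some coefficient in some relation among the
    generators.\<close>
  define Q where "Q e \<longleftrightarrow> (\<exists>c i u. rel c \<and> i \<in> I \<and> u \<in> zloc_units p \<and> c i = of_nat p ^ e * u)" for e
  have relQ: "\<exists>e u. Q e \<and> u \<in> zloc_units p \<and> c i = of_nat p ^ e * u" if "rel c" "i \<in> I" "c i \<noteq> 0" for c i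
  proof -
    obtain e u where "u \<in> zloc_units p" "c i = of_nat p ^ e * u"
      using zloc_unit_cases[of "c i"] \<open>rel c\<close> \<open>c i \<noteq> 0\<close> unfolding rel_def by metis
    then show ?thesis using that unfolding Q_def by blast
  qed
  show ?case
  proof (cases "\<exists>e. Q e")
    case False
    have "indep I b"
      unfolding indep_def
    proof (intro allI impI ballI)
      fix c i assume c: "\<forall>i. c i \<in> zloc p" "(\<Sum>i\<in>I. s (c i) (b i)) = 0" and i: "i \<in> I"
      then have "c i = 0" using relQ[of c i] False unfolding rel_def by blast
      then show "s (c i) (b i) = 0" by simp
    qed
    then show ?thesis by blast
  next
    case True
    define e where "e = (LEAST e. Q e)"
    have "Q e" using True unfolding e_def by (metis LeastI)
    then obtain c i u where ciu: "rel c" "i \<in> I" "u \<in> zloc_units p" "c i = of_nat p ^ e * u"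
      unfolding Q_def by blast
    have ci0: "c i \<noteq> 0" using ciu units_nz p_nz by simp
    \<comment> \<open>Minimality of \<open>e\<close>: the pivot \<open>c i\<close> divides every
      coefficient of every relation.\<close>
    have min: "c' j / c i \<in> zloc p" if "rel c'" "j \<in> I" for c' j
    proof (cases "c' j = 0")
      case False
      then obtain e' u' where e': "Q e'" "u' \<in> zloc_units p" "c' j = of_nat p ^ e' * u'"
        using relQ[of c' j] \<open>rel c'\<close> \<open>j \<in> I\<close> by blast
      have "e \<le> e'" unfolding e_def using e'(1) by (rule Least_le)
      then have "c' j / c i = of_nat p ^ (e' - e) * (u' / u)"
        using e' ciu(4) p_nz by (simp add: power_diff)
      then show ?thesis using e'(2) ciu(3) zloc_divide_unit units_zloc by simp
    qed simp
    \<comment> \<open>The relation \<open>c\<close> divided by its pivot. Since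
      \<open>r i = 1\<close>, the combination \<open>bi\<close> can replace \<open>b i\<close> as a
      generator, and it is killed by \<open>c i\<close>.\<close>
    define r where "r j = (if j \<in> I then c j / c i else 0)" for j
    have r: "r j \<in> zloc p" for j using min[OF ciu(1)] by (auto simp: r_def)
    define bi where "bi = (\<Sum>j\<in>I. s (r j) (b j))"
    define J where "J = I - {i}"
    have J: "finite J" "J \<subset> I" "i \<notin> J" and IJ: "I = insert i J"
      using psubset.hyps ciu(2) by (auto simp: J_def)
    have c_zloc: "c j \<in> zloc p" for j using ciu(1) by (auto simp: rel_def)
    have "s (c i) bi = (\<Sum>j\<in>I. s (c j) (b j))"
      unfolding bi_def s_sum[OF c_zloc]
    proof (intro sum.cong refl)
      fix j assume "j \<in> I"
      then show "s (c i) (s (r j) (b j)) = s (c j) (b j)"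
        using s_mult[OF c_zloc r, of i j "b j"] ci0 by (simp add: r_def)
    qed
    then have cibi: "s (c i) bi = 0" using ciu(1) by (simp add: rel_def)
    obtain b'' where b'': "gspan J b'' = gspan J b" "indep J b''"
      using psubset.IH[OF J(2), of b] by blast
    define b' where "b' = b''(i := bi)"
    have sum_b': "(\<Sum>j\<in>I. s (d j) (b' j)) = s (d i) bi + (\<Sum>j\<in>J. s (d j) (b'' j))" for d
      unfolding IJ using J by (simp add: b'_def) (intro sum.cong; auto)
    have Jsub: "gspan J b'' \<subseteq> gspan I b'"
    proof (rule gspan_subset)
      fix j assume "j \<in> J"
      then have "b'' j = b' j" "j \<in> I" using J by (auto simp: b'_def)
      then show "b'' j \<in> gspan I b'" using gspan_gen[OF psubset.hyps(1), of j b'] by simp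
    qed
    have "gspan I b' \<subseteq> gspan I b"
    proof (rule gspan_subset)
      fix j assume j: "j \<in> I"
      show "b' j \<in> gspan I b"
      proof (cases "j = i")
        case True
        then show ?thesis using gspanI[of r b I] r by (simp add: b'_def bi_def)
      next
        case False
        then have "b'' j \<in> gspan J b"
          using gspan_gen[OF J(1), of j b''] b''(1) j by (simp add: J_def)
        moreover have "gspan J b \<subseteq> gspan I b"
          using J gspan_gen[OF psubset.hyps(1)] by (intro gspan_subset) auto
        ultimately show ?thesis using False by (auto simp: b'_def)
      qed
    qed
    moreover have "gspan I b \<subseteq> gspan I b'"
    proof (rule gspan_subset)
      fix j assume j: "j \<in> I"
      have bJ: "b j \<in> gspan I b'" if "j \<in> J" for j
        using gspan_gen[OF J(1) that, of b] b''(1) Jsub by blast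
      show "b j \<in> gspan I b'"
      proof (cases "j = i")
        case True
        have "bi = s (r i) (b i) + (\<Sum>j\<in>J. s (r j) (b j))"
          unfolding bi_def IJ using J by simp
        moreover have "r i = 1" using ci0 ciu(2) by (simp add: r_def)
        ultimately have "b i = bi - (\<Sum>j\<in>J. s (r j) (b j))" by simp
        moreover have "bi \<in> gspan I b'"
          using gspan_gen[OF psubset.hyps(1) ciu(2), of b'] by (simp add: b'_def)
        ultimately show ?thesis
          using True bJ r by (auto intro!: gspan_diff gspan_sum gspan_smult)
      next
        case False
        then show ?thesis using bJ j by (simp add: J_def)
      qed
    qed
    moreover have "indep I b'"
      unfolding indep_def
    proof (intro allI impI)
      fix d assume d: "\<forall>i. d i \<in> zloc p" and d0: "(\<Sum>i\<in>I. s (d i) (b' i)) = 0"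
      define w where "w = (\<Sum>j\<in>J. s (d j) (b'' j))"
      have sw: "s (d i) bi + w = 0" using d0 unfolding sum_b' w_def .
      have "w \<in> gspan J b" using gspanI[of d b'' J] d b''(1) by (auto simp: w_def)
      then obtain f where f: "\<And>j. f j \<in> zloc p" "w = (\<Sum>j\<in>J. s (f j) (b j))"
        by (rule gspanE) blast
      \<comment> \<open>The relation \<open>d\<close> among the new generators, rewritten in the old
        ones. Only \<open>bi\<close> involves \<open>b i\<close>, so the coefficient at
        \<open>i\<close> is \<open>d i\<close>, which \<open>c i\<close> therefore divides; hence
        \<open>d i\<close> kills \<open>bi\<close>.\<close>
      define g where "g j = d i * r j + (if j \<in> J then f j else 0)" for j
      have "(\<Sum>j\<in>I. s (g j) (b j)) = (\<Sum>j\<in>I. s (d i) (s (r j) (b j)) + (if j \<in> J then s (f j) (b j) else 0))"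
        unfolding g_def using d r f by (intro sum.cong) (auto simp: s_add_left s_mult)
      also have "\<dots> = s (d i) bi + (\<Sum>j\<in>I. if j \<in> J then s (f j) (b j) else 0)"
        using d by (simp add: sum.distrib bi_def s_sum)
      also have "(\<Sum>j\<in>I. if j \<in> J then s (f j) (b j) else 0) = w"
        unfolding f(2) using J psubset.hyps by (subst sum.inter_restrict[symmetric]) (auto intro!: sum.cong)
      finally have "rel g" using sw d r f by (auto simp: rel_def g_def)
      then have "g i / c i \<in> zloc p" using min ciu(2) by blast
      moreover have "g i = d i" using ci0 J ciu(2) by (simp add: g_def r_def)
      ultimately have "d i / c i \<in> zloc p" by simp
      then have "s (d i / c i * c i) bi = 0"
        using s_mult[of "d i / c i" "c i" bi] c_zloc cibi by simp
      then have di: "s (d i) bi = 0" using ci0 by simp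
      then have "w = 0" using sw by simp
      then have "s (d j) (b'' j) = 0" if "j \<in> J" for j
        using indepD[OF b''(2)] d that by (simp add: w_def)
      then show "\<forall>j\<in>I. s (d j) (b' j) = 0"
        using di by (auto simp: IJ b'_def)
    qed
    ultimately show ?thesis by blast
  qed
qed

text \<open>After \<open>indep_generators\<close> each summand has a generator that is torsion-free
  or killed by a power of \<open>p\<close>. In a torsion-free summand divisibility by all
  \<open>p^m\<close> forces a zero coefficient; all other summands are killed by a common
  \<open>p^E\<close>.\<close>

lemma gspan_separated:
  assumes "finite I"
  shows gspan_krull: "\<lbrakk>y \<in> gspan I b; \<And>m. \<exists>z\<in>gspan I b. y = s (of_nat p ^ m) z\<rbrakk> \<Longrightarrow> y = 0"
    and gspan_torsion: "\<exists>e. \<forall>z\<in>gspan I b. \<forall>K::int. K \<noteq> 0 \<longrightarrow> s (of_int K) (s (of_nat p ^ e) z) = 0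
      \<longrightarrow> s (of_nat p ^ e) z = 0"
proof -
  obtain b' where b': "gspan I b' = gspan I b" "indep I b'"
    using indep_generators[OF assms] by blast
  \<comment> \<open>For a generator that no power of \<open>p\<close> kills, this
    \<open>LEAST\<close> is an unspecified number; \<open>E\<close> only has to bound the relevant
    exponents from above.\<close>
  define n where "n i = (LEAST n. s (of_nat p ^ n) (b' i) = 0)" for i
  have n: "s (of_nat p ^ n i) (b' i) = 0" if "\<exists>n. s (of_nat p ^ n) (b' i) = 0" for i
    unfolding n_def using that by (rule LeastI_ex)
  define E where "E = (\<Sum>i\<in>I. n i)"
  have E: "s (of_nat p ^ E) (b' i) = 0" if "i \<in> I" and c: "c \<in> zloc p" "c \<noteq> 0" and "s c (b' i) = 0" for i c
  proof -
    obtain e u where eu: "u \<in> zloc_units p" "c = of_nat p ^ e * u"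
      using zloc_unit_cases c by metis
    have "inverse u * c = of_nat p ^ e" using eu units_nz[OF eu(1)] by simp
    then have "s (of_nat p ^ e) (b' i) = s (inverse u * c) (b' i)" by simp
    also have "\<dots> = 0" using eu that by (simp add: s_mult units_inverse units_zloc)
    finally have "s (of_nat p ^ n i) (b' i) = 0" using n by blast
    moreover have "n i \<le> E" unfolding E_def using assms that(1) by (intro member_le_sum) auto
    ultimately show ?thesis
      using s_mult[of "of_nat p ^ (E - n i)" "of_nat p ^ n i" "b' i"] by (simp add: power_add[symmetric])
  qed
  \<comment> \<open>Directness of the decomposition lets an equality \<open>y = p^m z\<close> be
    compared summand by summand.\<close>
  have rel: "s (c i) (b' i) = s (of_nat p ^ m) (s (d i) (b' i))" if "i \<in> I"
    "\<And>i. c i \<in> zloc p" "\<And>i. d i \<in> zloc p"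
    "(\<Sum>i\<in>I. s (c i) (b' i)) = s (of_nat p ^ m) (\<Sum>i\<in>I. s (d i) (b' i))" for c d m i
  proof -
    have "(\<Sum>i\<in>I. s (c i - of_nat p ^ m * d i) (b' i)) = 0"
      using that by (simp add: s_diff_left s_mult sum_subtractf s_sum)
    then have "s (c i - of_nat p ^ m * d i) (b' i) = 0"
      using indepD[OF b'(2), of "\<lambda>i. c i - of_nat p ^ m * d i" i] that by simp
    then show ?thesis using that by (simp add: s_diff_left s_mult)
  qed
  have kill: "s (of_nat p ^ E) (s d (b' i)) = 0" if "s (of_nat p ^ E) (b' i) = 0" "d \<in> zloc p" for d i
    using that s_mult[of d "of_nat p ^ E" "b' i"] s_mult[of "of_nat p ^ E" d "b' i"]
    by (simp add: mult.commute)
  show "y = 0" if y: "y \<in> gspan I b" and ym: "\<And>m. \<exists>z\<in>gspan I b. y = s (of_nat p ^ m) z"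
  proof -
    obtain c where c: "\<And>i. c i \<in> zloc p" "y = (\<Sum>i\<in>I. s (c i) (b' i))"
      using y unfolding b'(1)[symmetric] by (rule gspanE) blast
    have "\<exists>d. (\<forall>i. d i \<in> zloc p) \<and> y = s (of_nat p ^ m) (\<Sum>i\<in>I. s (d i) (b' i))" for m
    proof -
      obtain z where z: "z \<in> gspan I b'" "y = s (of_nat p ^ m) z"
        using ym[of m] b'(1) by blast
      from z(1) obtain d where "\<And>i. d i \<in> zloc p" "z = (\<Sum>i\<in>I. s (d i) (b' i))"
        by (rule gspanE) blast
      then show ?thesis using z(2) by blast
    qed
    then obtain d where d: "\<And>m i. d m i \<in> zloc p" "\<And>m. y = s (of_nat p ^ m) (\<Sum>i\<in>I. s (d m i) (b' i))"
      by metis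
    have "s (c i) (b' i) = 0" if "i \<in> I" for i
    proof (cases "s (of_nat p ^ E) (b' i) = 0")
      case True
      have "s (c i) (b' i) = s (of_nat p ^ E) (s (d E i) (b' i))"
        by (rule rel[OF that]) (use c d in auto)
      then show ?thesis using kill[OF True d(1)] by simp
    next
      case False
      have "c i / of_nat p ^ m \<in> zloc p" for m
      proof -
        have "s (c i - of_nat p ^ m * d m i) (b' i) = 0"
        proof -
          have "s (c i) (b' i) = s (of_nat p ^ m) (s (d m i) (b' i))"
            by (rule rel[OF that]) (use c d in auto)
          then show ?thesis using c d by (simp add: s_diff_left s_mult)
        qed
        then have "c i - of_nat p ^ m * d m i = 0"
          using E[OF that, of "c i - of_nat p ^ m * d m i"] False c d by blast
        then have "c i / of_nat p ^ m = d m i" using p_nz by simp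
        then show ?thesis using d by simp
      qed
      then have "c i = 0" using p_power_dvd_imp_0 c by blast
      then show ?thesis by simp
    qed
    then show ?thesis using c by simp
  qed
  show "\<exists>e. \<forall>z\<in>gspan I b. \<forall>K::int. K \<noteq> 0 \<longrightarrow> s (of_int K) (s (of_nat p ^ e) z) = 0
      \<longrightarrow> s (of_nat p ^ e) z = 0"
  proof (intro exI ballI allI impI)
    fix z and K :: int
    assume z: "z \<in> gspan I b" and K: "K \<noteq> 0" "s (of_int K) (s (of_nat p ^ E) z) = 0"
    obtain c where c: "\<And>i. c i \<in> zloc p" "z = (\<Sum>i\<in>I. s (c i) (b' i))"
      using z unfolding b'(1)[symmetric] by (rule gspanE) blast
    have "(\<Sum>i\<in>I. s (of_int K * of_nat p ^ E * c i) (b' i)) = 0"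
      using K(2) c by (simp add: s_sum s_mult)
    then have K0: "s (of_int K * of_nat p ^ E * c i) (b' i) = 0" if "i \<in> I" for i
      using indepD[OF b'(2), of "\<lambda>i. of_int K * of_nat p ^ E * c i"] c that by simp
    have "s (of_nat p ^ E) (s (c i) (b' i)) = 0" if "i \<in> I" for i
    proof (cases "c i = 0")
      case False
      then have "of_int K * of_nat p ^ E * c i \<noteq> 0" using K(1) p_nz by simp
      then have "s (of_nat p ^ E) (b' i) = 0" using E[OF that _ _ K0[OF that]] c by simp
      then show ?thesis using kill c by blast
    qed simp
    then show "s (of_nat p ^ E) z = 0" using c by (simp add: s_sum)
  qed
qed

end

section \<open>Polynomials over the $p$-local integers\<close>


context plocal
begin

definition zpoly :: "rat poly set" where
  "zpoly = {P. \<forall>i. coeff P i \<in> zloc p}"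

lemma zpolyD: "P \<in> zpoly \<Longrightarrow> coeff P i \<in> zloc p"
  by (simp add: zpoly_def)

lemma zpoly_0 [simp, intro]: "0 \<in> zpoly"
  by (simp add: zpoly_def)

lemma zpoly_pCons_iff [simp]: "pCons a P \<in> zpoly \<longleftrightarrow> a \<in> zloc p \<and> P \<in> zpoly"
  unfolding zpoly_def by (auto simp: coeff_pCons split: nat.splits)

lemma zpoly_1 [simp, intro]: "1 \<in> zpoly"
  by (simp add: one_pCons)

lemma zpoly_add [simp, intro]: "P \<in> zpoly \<Longrightarrow> Q \<in> zpoly \<Longrightarrow> P + Q \<in> zpoly"
  and zpoly_diff [simp, intro]: "P \<in> zpoly \<Longrightarrow> Q \<in> zpoly \<Longrightarrow> P - Q \<in> zpoly"
  and zpoly_uminus [simp, intro]: "P \<in> zpoly \<Longrightarrow> - P \<in> zpoly"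
  and zpoly_smult [simp, intro]: "c \<in> zloc p \<Longrightarrow> P \<in> zpoly \<Longrightarrow> smult c P \<in> zpoly"
  and zpoly_monom [simp, intro]: "c \<in> zloc p \<Longrightarrow> monom c n \<in> zpoly"
  by (auto simp: zpoly_def)

lemma zpoly_mult [simp, intro]: "P \<in> zpoly \<Longrightarrow> Q \<in> zpoly \<Longrightarrow> P * Q \<in> zpoly"
  by (auto simp: zpoly_def coeff_mult intro!: zloc_sum)

lemma zpoly_power [simp, intro]: "P \<in> zpoly \<Longrightarrow> P ^ n \<in> zpoly"
  by (induction n) auto

lemma zpoly_sum [intro]: "(\<And>i. i \<in> I \<Longrightarrow> f i \<in> zpoly) \<Longrightarrow> (\<Sum>i\<in>I. f i) \<in> zpoly"
  by (induction I rule: infinite_finite_induct) auto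

lemma zpoly_prod [intro]: "(\<And>i. i \<in> I \<Longrightarrow> f i \<in> zpoly) \<Longrightarrow> (\<Prod>i\<in>I. f i) \<in> zpoly"
  by (induction I rule: infinite_finite_induct) auto

lemma zpoly_poly: "P \<in> zpoly \<Longrightarrow> a \<in> zloc p \<Longrightarrow> poly P a \<in> zloc p"
  by (induction P) auto

lemma zpoly_synthetic_div: "P \<in> zpoly \<Longrightarrow> a \<in> zloc p \<Longrightarrow> synthetic_div P a \<in> zpoly"
  by (induction P) (auto intro: zpoly_poly)

section \<open>Congruence of polynomials modulo \<open>p\<close> and the Frobenius\<close>

definition pcong :: "rat poly \<Rightarrow> rat poly \<Rightarrow> bool" where
  "pcong P Q \<longleftrightarrow> (\<exists>E\<in>zpoly. P - Q = smult (of_nat p) E)"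

lemma pcong_refl: "pcong P P"
  unfolding pcong_def by (rule bexI[of _ 0]) auto

lemma pcong_trans [trans]:
  assumes "pcong P Q" "pcong Q R" shows "pcong P R"
proof -
  obtain E F where "E \<in> zpoly" "P - Q = smult (of_nat p) E" "F \<in> zpoly" "Q - R = smult (of_nat p) F"
    using assms unfolding pcong_def by blast
  moreover from this have "P - R = smult (of_nat p) (E + F)" by (simp add: smult_add_right algebra_simps)
  ultimately show ?thesis unfolding pcong_def by blast
qed

lemma pcong_mult:
  assumes "pcong P Q" "pcong P' Q'" "P' \<in> zpoly" "Q \<in> zpoly"
  shows "pcong (P * P') (Q * Q')"
proof -
  obtain E F where EF: "E \<in> zpoly" "P - Q = smult (of_nat p) E" "F \<in> zpoly" "P' - Q' = smult (of_nat p) F"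
    using assms unfolding pcong_def by blast
  have "P * P' - Q * Q' = (P - Q) * P' + Q * (P' - Q')" by (simp add: algebra_simps)
  also have "\<dots> = smult (of_nat p) (E * P' + Q * F)"
    by (simp add: EF smult_add_right)
  finally show ?thesis using EF assms unfolding pcong_def by blast
qed

lemma pcong_power:
  assumes "pcong P Q" "P \<in> zpoly" "Q \<in> zpoly" shows "pcong (P ^ n) (Q ^ n)"
  using assms by (induction n) (auto intro: pcong_mult pcong_refl)

text \<open>The inner binomial coefficients of a prime row are divisible by \<open>p\<close>;
  oddness of \<open>p\<close> makes the constant term \<open>(-1)^p\<close> equal to
  \<open>-1\<close>.\<close>

lemma pcong_frobenius:
  assumes "A \<in> zpoly" "odd p" shows "pcong ((A - 1) ^ p) (A ^ p - 1)"
proof -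
  define t where "t k = of_nat (p choose k) * A ^ k * (- 1) ^ (p - k)" for k
  define E where "E = (\<Sum>k\<in>{1..<p}. smult (of_nat ((p choose k) div p)) (A ^ k * (- 1) ^ (p - k)))"
  have t: "t k = smult (of_nat p) (smult (of_nat ((p choose k) div p)) (A ^ k * (- 1) ^ (p - k)))"
    if k: "k \<in> {1..<p}" for k
  proof -
    have "p dvd (p choose k)" using k prime_p by (intro dvd_choose_prime) auto
    then have "p choose k = p * ((p choose k) div p)" by simp
    then have "(of_nat (p choose k) :: rat poly) = of_nat p * of_nat ((p choose k) div p)"
      by (metis of_nat_mult)
    then show ?thesis by (simp add: t_def of_nat_poly mult.commute)
  qed
  have "(A - 1) ^ p = (\<Sum>k\<le>p. t k)"
    using binomial_ring[of A "- 1" p] by (simp add: t_def)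
  also have "{..p} = insert 0 (insert p {1..<p})" by auto
  also have "(\<Sum>k\<in>\<dots>. t k) = t 0 + (t p + (\<Sum>k\<in>{1..<p}. t k))"
    by (subst sum.insert; simp)
  also have "(\<Sum>k\<in>{1..<p}. t k) = smult (of_nat p) E"
  proof -
    have "smult c (\<Sum>k\<in>I. f k) = (\<Sum>k\<in>I. smult c (f k))" for c :: rat and f and I :: "nat set"
      by (induction I rule: infinite_finite_induct) (simp_all add: smult_add_right)
    then show ?thesis unfolding E_def using t by simp
  qed
  finally have "(A - 1) ^ p - (A ^ p - 1) = smult (of_nat p) E"
    using assms(2) by (simp add: t_def)
  moreover have "E \<in> zpoly" unfolding E_def using assms by (intro zpoly_sum) auto
  ultimately show ?thesis unfolding pcong_def by blast
qed

lemma pcong_frobenius_power: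
  assumes "A \<in> zpoly" "odd p" shows "pcong ((A - 1) ^ (p ^ k)) (A ^ (p ^ k) - 1)"
proof (induction k)
  case (Suc k)
  have "pcong (((A - 1) ^ (p ^ k)) ^ p) ((A ^ (p ^ k) - 1) ^ p)"
    using Suc assms by (intro pcong_power) auto
  also have "pcong ((A ^ (p ^ k) - 1) ^ p) ((A ^ (p ^ k)) ^ p - 1)"
    using assms by (intro pcong_frobenius) auto
  finally show ?case by (simp add: power_mult[symmetric] mult.commute)
qed (simp add: pcong_refl)

text \<open>Lagrange's bound on roots over the field with \<open>p\<close> elements, phrased without
  the quotient. Splitting off \<open>X - a\<close> leaves the remainder \<open>P(a)\<close>, a
  multiple of \<open>p\<close>, and a quotient of smaller degree that keeps the other roots modulo
  \<open>p\<close>.\<close>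

lemma pcong_0_if_many_roots:
  assumes "finite S" "P \<in> zpoly" "P = 0 \<or> degree P < card S" "S \<subseteq> zloc p"
    "\<And>a. a \<in> S \<Longrightarrow> poly P a / of_nat p \<in> zloc p"
    "\<And>a b. a \<in> S \<Longrightarrow> b \<in> S \<Longrightarrow> a \<noteq> b \<Longrightarrow> a - b \<in> zloc_units p"
  shows "pcong P 0"
  using assms
proof (induction S arbitrary: P rule: finite_induct)
  case (insert a S)
  define g where "g = synthetic_div P a"
  have Pg: "P = [:- a, 1:] * g + [:poly P a:]"
    unfolding g_def by (rule synthetic_div_correct'[symmetric])
  have g: "g \<in> zpoly" unfolding g_def using insert.prems by (intro zpoly_synthetic_div) auto
  have "pcong g 0"
  proof (rule insert.IH)
    show "g = 0 \<or> degree g < card S"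
      using insert.prems(2) insert.hyps unfolding g_def synthetic_div_eq_0_iff degree_synthetic_div
      by auto
    fix b assume b: "b \<in> S"
    \<comment> \<open>The quotient takes the value \<open>(P(b) - P(a)) / (b - a)\<close> at another
      root; dividing by the unit \<open>b - a\<close> preserves divisibility by
      \<open>p\<close>.\<close>
    have "poly P b = (b - a) * poly g b + poly P a"
      by (subst Pg) (simp add: algebra_simps)
    then have eq: "poly g b = (poly P b - poly P a) / (b - a)"
      using b insert.hyps by auto
    have "poly P b / of_nat p - poly P a / of_nat p \<in> zloc p"
      by (rule zloc_diff; rule insert.prems(4)) (use b in auto)
    moreover have "b - a \<in> zloc_units p"
      by (rule insert.prems(5)) (use b insert.hyps in auto)
    ultimately have "(poly P b / of_nat p - poly P a / of_nat p) / (b - a) \<in> zloc p"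
      by (rule zloc_divide_unit)
    then show "poly g b / of_nat p \<in> zloc p"
      unfolding eq by (simp add: diff_divide_distrib mult.commute)
  qed (use insert.prems g in auto)
  then obtain E where E: "E \<in> zpoly" "g = smult (of_nat p) E" unfolding pcong_def by auto
  have "P - 0 = smult (of_nat p) ([:- a, 1:] * E + [:poly P a / of_nat p:])"
    using E p_nz by (subst Pg) (simp add: smult_add_right)
  moreover have "[:- a, 1:] * E + [:poly P a / of_nat p:] \<in> zpoly"
    using E insert.prems by (intro zpoly_add zpoly_mult) auto
  ultimately show ?case unfolding pcong_def by blast
qed (auto intro: pcong_refl)

end

context primroot
begin

lemma q_zloc [simp, intro]: "of_int q powi k \<in> zloc p"
  using units_zloc units_powi q_unit by blast

text \<open>Euler's theorem with \<open>totient (p^(k+1)) = (p - 1) p^k\<close>, applied to the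
  natural number \<open>g\<close> congruent to \<open>q\<close>.\<close>

lemma q_euler: "int p ^ Suc k dvd q ^ ((p - 1) * p ^ k) - 1"
proof -
  define g where "g = nat (q mod int p ^ Suc k)"
  have K: "int p ^ Suc k > 0" by simp
  have g: "int g = q mod int p ^ Suc k"
    unfolding g_def using pos_mod_sign[OF K] by simp
  have "\<not> int p dvd int g"
    unfolding g using q_not_dvd by (simp add: dvd_mod_iff)
  then have "coprime g (p ^ Suc k)"
    using prime_imp_coprime_nat[OF prime_p, of g] by (simp add: coprime_commute)
  then have "[g ^ totient (p ^ Suc k) = 1] (mod p ^ Suc k)"
    by (rule euler_theorem)
  then have "[g ^ ((p - 1) * p ^ k) = 1] (mod p ^ Suc k)"
    using totient_prime_power[OF prime_p, of "Suc k"] by (simp add: mult.commute)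
  then have "[int g ^ ((p - 1) * p ^ k) = 1] (mod int p ^ Suc k)"
    by (metis cong_int_iff of_nat_1 of_nat_power)
  moreover have "[int g ^ ((p - 1) * p ^ k) = q ^ ((p - 1) * p ^ k)] (mod int p ^ Suc k)"
    unfolding g by (intro cong_pow) (simp add: cong_def)
  ultimately have "[q ^ ((p - 1) * p ^ k) = 1] (mod int p ^ Suc k)"
    by (metis cong_sym cong_trans)
  then show ?thesis by (simp add: cong_iff_dvd_diff)
qed

section \<open>Products of \<open>X - q^k\<close> over sets of exponents\<close>

definition window :: "nat \<Rightarrow> nat \<Rightarrow> rat poly" where
  "window l n = (\<Prod>i\<in>{l..<l + n}. [:- (of_int q ^ i), 1:])"

lemma window_zpoly [simp, intro]: "window l n \<in> zpoly"
  unfolding window_def using zloc_power[OF zloc_of_int] by (intro zpoly_prod) simp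

lemma window_add: "window l (m + n) = window l m * window (l + m) n"
  unfolding window_def by (simp add: prod.atLeastLessThan_concat add.assoc)

text \<open>Both sides are monic of degree \<open>p - 1\<close> and vanish modulo \<open>p\<close> at the \<open>p - 1\<close> roots of the window.\<close>

lemma window_period: "pcong (window l (p - 1)) (monom 1 (p - 1) - 1)"
proof -
  let ?S = "(\<lambda>i. (of_int q :: rat) ^ i) ` {l..<l + (p - 1)}"
  let ?P = "window l (p - 1) - (monom 1 (p - 1) - 1)"
  have p1: "p - 1 > 0" using prime_gt_1_nat[OF prime_p] by simp
  have diff: "of_int q ^ s - of_int q ^ t \<in> zloc_units p"
    if st: "s \<noteq> t" "s \<in> {l..<l + (p - 1)}" "t \<in> {l..<l + (p - 1)}" for s t
  proof -
    \<comment> \<open>Factoring out \<open>q^l\<close>, which is prime to \<open>p\<close>, moves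
      both exponents below \<open>p - 1\<close>.\<close>
    have "q ^ s - q ^ t = q ^ l * (q ^ (s - l) - q ^ (t - l))"
      using st by (simp add: right_diff_distrib power_add[symmetric])
    moreover have "\<not> int p dvd q ^ l" using q_not_dvd prime_dvd_power[of "int p" q l] prime_p by auto
    moreover have "\<not> int p dvd q ^ (s - l) - q ^ (t - l)"
      using st by (intro q_power_diff_unit) auto
    ultimately have "\<not> int p dvd q ^ s - q ^ t" using not_dvd_mult by metis
    then show ?thesis using of_int_unit[of "q ^ s - q ^ t"] by simp
  qed
  have inj: "inj_on (\<lambda>i. (of_int q :: rat) ^ i) {l..<l + (p - 1)}"
  proof (rule inj_onI, rule ccontr)
    fix s t assume st: "s \<in> {l..<l + (p - 1)}" "t \<in> {l..<l + (p - 1)}"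
      "(of_int q :: rat) ^ s = of_int q ^ t" "s \<noteq> t"
    show False using units_nz[OF diff[OF st(4,1,2)]] st(3) by simp
  qed
  have card: "card ?S = p - 1" using card_image[OF inj] by simp
  have "pcong ?P 0"
  proof (rule pcong_0_if_many_roots)
    \<comment> \<open>Both polynomials are monic of degree \<open>p - 1\<close>, so the leading
      terms cancel and the degree drops below the number of roots.\<close>
    have "lead_coeff (\<Prod>i\<in>I. [:- c i, 1:]) = 1" for c :: "nat \<Rightarrow> rat" and I
      by (induction I rule: infinite_finite_induct) (simp_all add: lead_coeff_mult
          del: mult_pCons_left mult_pCons_right)
    then have "lead_coeff (window l (p - 1)) = 1" by (simp only: window_def)
    moreover have deg: "degree (window l (p - 1)) = p - 1"
      unfolding window_def by (subst degree_prod_eq_sum_degree) simp_all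
    moreover have "degree (window l (p - 1)) \<le> p - 1" using deg by simp
    moreover have "degree (monom 1 (p - 1) - 1 :: rat poly) \<le> p - 1"
      by (intro degree_diff_le) (auto simp: degree_monom_eq)
    ultimately have "degree ?P \<le> p - 1" "coeff ?P (p - 1) = 0"
      using p1 by (auto intro: degree_diff_le)
    then show "?P = 0 \<or> degree ?P < card ?S"
      unfolding card by (metis eq_zero_or_degree_less)
    show "?S \<subseteq> zloc p" using zloc_power[OF zloc_of_int] by auto
    show "poly ?P a / of_nat p \<in> zloc p" if a: "a \<in> ?S" for a
    proof -
      obtain i where i: "i \<in> {l..<l + (p - 1)}" "a = of_int q ^ i" using a by blast
      \<comment> \<open>By Fermat's little theorem \<open>X^(p-1) - 1\<close> vanishes modulo
        \<open>p\<close> at \<open>a = q^i\<close>, and the window vanishes there exactly.\<close>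
      have "int p ^ 1 dvd (q ^ (p - 1)) ^ i - 1 ^ i"
        using q_euler[of 0] power_diff_sumr2[of "q ^ (p - 1)" i 1]
        by simp
      then have "of_int ((q ^ (p - 1)) ^ i - 1 ^ i) / of_nat p ^ 1 \<in> zloc p"
        by (rule zloc_dvd_of_int)
      moreover have "poly (window l (p - 1)) a = 0"
        unfolding window_def poly_prod using i by (auto intro!: prod_zero)
      ultimately have "- (of_int ((q ^ (p - 1)) ^ i - 1 ^ i) / of_nat p ^ 1) = poly ?P a / of_nat p"
        using i(2) by (simp add: poly_monom power_mult[symmetric] mult.commute diff_divide_distrib)
      then show ?thesis
        using \<open>of_int ((q ^ (p - 1)) ^ i - 1 ^ i) / of_nat p ^ 1 \<in> zloc p\<close> by (metis zloc_uminus)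
    qed
    show "a - b \<in> zloc_units p" if ab: "a \<in> ?S" "b \<in> ?S" "a \<noteq> b" for a b
    proof -
      obtain i j where ij: "a = of_int q ^ i" "b = of_int q ^ j"
        "i \<in> {l..<l + (p - 1)}" "j \<in> {l..<l + (p - 1)}"
        using ab by blast
      then have "i \<noteq> j" using ab(3) by blast
      then show ?thesis using diff ij by blast
    qed
  qed auto
  then show ?thesis unfolding pcong_def by simp
qed

text \<open>A window of length \<open>(p - 1) p^k\<close> is a concatenation of \<open>p^k\<close>
  windows of length \<open>p - 1\<close>, each congruent to the same \<open>X^(p-1) - 1\<close>
  whatever its starting point; Frobenius evaluates the resulting power.\<close>

lemma window_frobenius: "pcong (window l ((p - 1) * p ^ k)) (monom 1 ((p - 1) * p ^ k) - 1)"
proof -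
  have "pcong (window l ((p - 1) * n)) ((monom 1 (p - 1) - 1) ^ n)" for n
  proof (induction n arbitrary: l)
    case (Suc n)
    have "window l ((p - 1) * Suc n) = window l (p - 1) * window (l + (p - 1)) ((p - 1) * n)"
      by (simp add: window_add[symmetric])
    then show ?case using Suc window_period by (auto intro!: pcong_mult)
  qed (simp add: window_def pcong_refl)
  also have "pcong ((monom 1 (p - 1) - 1) ^ p ^ k) (monom 1 (p - 1) ^ p ^ k - 1)"
    using odd_p by (intro pcong_frobenius_power) auto
  finally show ?thesis by (simp add: monom_power)
qed

definition vanish_poly :: "int set \<Rightarrow> rat poly" where
  "vanish_poly K = (\<Prod>k\<in>K. [:- (of_int q powi k), 1:])"

lemma vanish_poly_zpoly [simp, intro]: "vanish_poly K \<in> zpoly"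
  unfolding vanish_poly_def by (intro zpoly_prod) simp

lemma vanish_poly_Un: "finite K \<Longrightarrow> finite K' \<Longrightarrow> vanish_poly (K \<union> K') = vanish_poly (K' - K) * vanish_poly K"
  unfolding vanish_poly_def by (subst prod.union_disjoint[symmetric]) (auto simp: Un_commute)

lemma vanish_poly_window: "vanish_poly (int ` {..<n}) = window 0 n"
  unfolding vanish_poly_def window_def by (subst prod.reindex) (auto simp: inj_on_def lessThan_atLeast0)

lemma poly_vanish_poly: "poly (vanish_poly K) x = (\<Prod>k\<in>K. x - of_int q powi k)"
  by (simp add: vanish_poly_def poly_prod)

lemma poly_vanish_poly_eq_0_iff: "finite K \<Longrightarrow> poly (vanish_poly K) (of_int q powi k) = 0 \<longleftrightarrow> k \<in> K"
  using q_inj_pow by (auto simp: poly_vanish_poly dest: injD)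

text \<open>The roots are distinct, so the linear factors split off one after the other; each is
  monic, hence division keeps the coefficients \<open>p\<close>-local.\<close>

lemma vanish_poly_divides:
  assumes "finite K" "P \<in> zpoly" "\<And>k. k \<in> K \<Longrightarrow> poly P (of_int q powi k) = 0"
  obtains Q where "Q \<in> zpoly" "P = Q * vanish_poly K"
proof -
  have "\<exists>Q\<in>zpoly. P = Q * vanish_poly K"
    using assms
  proof (induction K arbitrary: P rule: finite_induct)
    case (insert k K)
    define Q where "Q = synthetic_div P (of_int q powi k)"
    have P: "P = [:- (of_int q powi k), 1:] * Q"
      using synthetic_div_correct'[of "of_int q powi k" P] insert.prems by (simp add: Q_def)
    have Q: "Q \<in> zpoly"
      unfolding Q_def using insert.prems by (intro zpoly_synthetic_div) auto
    have "poly Q (of_int q powi l) = 0" if l: "l \<in> K" for l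
    proof -
      have "poly P (of_int q powi l) = 0" using insert.prems l by simp
      moreover have "(of_int q :: rat) powi l \<noteq> of_int q powi k"
        using l insert.hyps q_inj_pow by (auto dest: injD)
      ultimately show ?thesis by (simp add: P)
    qed
    then obtain R where "R \<in> zpoly" "Q = R * vanish_poly K" using insert.IH Q by blast
    then show ?case using P insert.hyps by (auto simp: vanish_poly_def mult_ac)
  qed (auto simp: vanish_poly_def)
  then show thesis using that by blast
qed

text \<open>The power \<open>p\<^sup>D\<close> absorbs the denominators of the divided differences in Newton's formula.\<close>

lemma interpolation:
  assumes "finite K"
  shows "\<exists>D. \<forall>v. (\<forall>k\<in>K. v k \<in> zloc p) \<longrightarrow>
    (\<exists>P\<in>zpoly. \<forall>k\<in>K. poly P (of_int q powi k) = of_nat p ^ D * v k)"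
  using assms
proof (induction K rule: finite_induct)
  case (insert k K)
  obtain D where D: "\<And>v. (\<forall>k\<in>K. v k \<in> zloc p) \<Longrightarrow>
    (\<exists>P\<in>zpoly. \<forall>k\<in>K. poly P (of_int q powi k) = of_nat p ^ D * v k)"
    using insert.IH by blast
  \<comment> \<open>The value at the new node of the product that vanishes at the old ones; its
    \<open>p\<close>-part \<open>p^d\<close> is the extra denominator to absorb.\<close>
  define t where "t = poly (vanish_poly K) (of_int q powi k)"
  have "t \<noteq> 0" "t \<in> zloc p"
    using insert.hyps poly_vanish_poly_eq_0_iff by (auto simp: t_def intro: zpoly_poly)
  then obtain d u where u: "u \<in> zloc_units p" "t = of_nat p ^ d * u"
    using zloc_unit_cases by metis
  show ?case
  proof (intro exI[of _ "D + d"] allI impI)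
    fix v assume v: "\<forall>k\<in>insert k K. v k \<in> zloc p"
    then obtain P where P: "P \<in> zpoly" "\<And>k. k \<in> K \<Longrightarrow> poly P (of_int q powi k) = of_nat p ^ D * v k"
      using D[of v] by blast
    \<comment> \<open>The error of the old interpolant at the new node. It is corrected by a
      multiple of \<open>vanish_poly K\<close>, which does not change the values at the old
      nodes.\<close>
    define \<delta> where "\<delta> = of_nat p ^ D * v k - poly P (of_int q powi k)"
    have \<delta>: "\<delta> \<in> zloc p" using v P by (auto simp: \<delta>_def intro: zpoly_poly)
    define P' where "P' = smult (of_nat p ^ d) P + smult (\<delta> / u) (vanish_poly K)"
    have "P' \<in> zpoly" unfolding P'_def using P \<delta> u by (auto intro: zloc_divide_unit)
    moreover have "poly P' (of_int q powi l) = of_nat p ^ (D + d) * v l" if "l \<in> K" for l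
      using that P insert.hyps poly_vanish_poly_eq_0_iff by (simp add: P'_def power_add)
    moreover have "poly P' (of_int q powi k) = of_nat p ^ (D + d) * v k"
    proof -
      have "poly P' (of_int q powi k) = of_nat p ^ d * poly P (of_int q powi k) + \<delta> / u * t"
        by (simp add: P'_def t_def)
      also have "\<delta> / u * t = of_nat p ^ d * \<delta>" using u units_nz by simp
      finally show ?thesis by (simp add: \<delta>_def power_add algebra_simps)
    qed
    ultimately show "\<exists>P\<in>zpoly. \<forall>k\<in>insert k K. poly P (of_int q powi k) = of_nat p ^ (D + d) * v k"
      by blast
  qed
qed (auto intro: zpoly_0)

end

section \<open>Polynomials in the Adams operation acting on a Bousfield module\<close>

locale bousfield = primroot +
  fixes actR :: "(rat \<Rightarrow> rat) \<Rightarrow> 'm::ab_group_add \<Rightarrow> 'm"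
  assumes bousfield: "bousfield_module p actR"
begin

section \<open>Group ring elements and the underlying module over the \<open>p\<close>-local
  integers\<close>

lemma act_add: "r \<in> grp_ring p \<Longrightarrow> actR r (x + y) = actR r x + actR r y"
  and act_gr_add: "r \<in> grp_ring p \<Longrightarrow> t \<in> grp_ring p \<Longrightarrow> actR (gr_add r t) x = actR r x + actR t x"
  and act_gr_mult: "r \<in> grp_ring p \<Longrightarrow> t \<in> grp_ring p \<Longrightarrow> actR (gr_mult r t) x = actR r (actR t x)"
  and act_one [simp]: "actR (gr_Psi 1) x = x"
  using bousfield unfolding bousfield_module_def R_module_def ring_action_def by blast+

lemma bous: "bous_a p actR x" "bous_b p actR x" "bous_c p actR x"
  using bousfield unfolding bousfield_module_def by blast+

lemma gr_const_in [simp, intro]: "c \<in> zloc p \<Longrightarrow> gr_const c \<in> grp_ring p"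
  by (auto simp: grp_ring_def gr_const_def intro: finite_subset[of _ "{1}"])

lemma gr_Psi_in [simp, intro]: "j \<in> zloc_units p \<Longrightarrow> gr_Psi j \<in> grp_ring p"
  by (auto simp: grp_ring_def gr_Psi_def intro: finite_subset[of _ "{j}"])

lemma gr_add_in [simp, intro]:
  assumes "r \<in> grp_ring p" "t \<in> grp_ring p" shows "gr_add r t \<in> grp_ring p"
proof -
  have "{j. gr_add r t j \<noteq> 0} \<subseteq> {j. r j \<noteq> 0} \<union> {j. t j \<noteq> 0}" by (auto simp: gr_add_def)
  then have "finite {j. gr_add r t j \<noteq> 0}"
    by (rule finite_subset) (use assms in \<open>auto simp: grp_ring_def\<close>)
  moreover have "j \<in> zloc_units p" if "gr_add r t j \<noteq> 0" for j
  proof -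
    have "r j \<noteq> 0 \<or> t j \<noteq> 0" using that by (auto simp: gr_add_def)
    then show ?thesis using assms by (auto simp: grp_ring_def)
  qed
  ultimately show ?thesis using assms by (simp add: grp_ring_def gr_add_def)
qed

lemma gr_const_mult: "gr_mult (gr_const c) r = (\<lambda>j. c * r j)"
proof -
  have "{i. gr_const c i \<noteq> 0} = (if c = 0 then {} else {1})" by (auto simp: gr_const_def)
  then show ?thesis by (auto simp: gr_mult_def gr_const_def)
qed

lemma gr_Psi_mult: "gr_mult (gr_Psi i) r = (\<lambda>j. r (j / i))"
proof -
  have "{k. gr_Psi i k \<noteq> 0} = {i}" by (auto simp: gr_Psi_def)
  then show ?thesis by (auto simp: gr_mult_def gr_Psi_def)
qed

lemma gr_const_mult_in [intro]:
  assumes "c \<in> zloc p" "r \<in> grp_ring p" shows "gr_mult (gr_const c) r \<in> grp_ring p"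
proof -
  have "finite {j. c * r j \<noteq> 0}"
    by (rule finite_subset[of _ "{j. r j \<noteq> 0}"]) (use assms in \<open>auto simp: grp_ring_def\<close>)
  then show ?thesis using assms unfolding gr_const_mult by (auto simp: grp_ring_def)
qed

lemma gr_Psi_mult_in [intro]:
  assumes "i \<in> zloc_units p" "r \<in> grp_ring p" shows "gr_mult (gr_Psi i) r \<in> grp_ring p"
proof -
  have i0: "i \<noteq> 0" using assms(1) by (rule units_nz)
  have sub: "{j. r (j / i) \<noteq> 0} \<subseteq> (\<lambda>j. i * j) ` {j. r j \<noteq> 0}"
  proof
    fix j assume "j \<in> {j. r (j / i) \<noteq> 0}"
    then have "j = i * (j / i)" "j / i \<in> {j. r j \<noteq> 0}" using i0 by auto
    then show "j \<in> (\<lambda>j. i * j) ` {j. r j \<noteq> 0}" by blast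
  qed
  have "finite {j. r (j / i) \<noteq> 0}"
    by (rule finite_subset[OF sub]) (use assms in \<open>auto simp: grp_ring_def\<close>)
  moreover have "j \<in> zloc_units p" if "r (j / i) \<noteq> 0" for j
  proof -
    have "j / i \<in> zloc_units p" using that assms by (auto simp: grp_ring_def)
    then have "i * (j / i) \<in> zloc_units p" using assms(1) by (intro units_mult)
    then show ?thesis using i0 by simp
  qed
  ultimately show ?thesis using assms unfolding gr_Psi_mult by (auto simp: grp_ring_def)
qed

abbreviation sm :: "rat \<Rightarrow> 'm \<Rightarrow> 'm" where "sm \<equiv> zsmul actR"

abbreviation Psi :: "rat \<Rightarrow> 'm \<Rightarrow> 'm" where "Psi j \<equiv> actR (gr_Psi j)"

sublocale zloc_module p sm
proof
  have "gr_const (c + d) = gr_add (gr_const c) (gr_const d)" for c d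
    by (auto simp: gr_const_def gr_add_def)
  moreover have "gr_const (c * d) = gr_mult (gr_const c) (gr_const d)" for c d
    unfolding gr_const_mult by (auto simp: gr_const_def)
  moreover have "gr_const 1 = gr_Psi 1" by (auto simp: gr_const_def gr_Psi_def)
  ultimately show "ring_action (zloc p) (+) (*) 1 sm"
    unfolding ring_action_def zsmul_def by (simp add: act_add act_gr_add act_gr_mult)
qed

lemma Psi_add: "j \<in> zloc_units p \<Longrightarrow> Psi j (x + y) = Psi j x + Psi j y"
  by (simp add: act_add)

lemma Psi_0: "j \<in> zloc_units p \<Longrightarrow> Psi j 0 = 0"
  using Psi_add[of j 0 0] by simp

lemma Psi_sum: "j \<in> zloc_units p \<Longrightarrow> Psi j (\<Sum>i\<in>I. f i) = (\<Sum>i\<in>I. Psi j (f i))"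
  by (induction I rule: infinite_finite_induct) (simp_all add: Psi_add Psi_0)

lemma Psi_sm:
  assumes "j \<in> zloc_units p" "c \<in> zloc p" shows "Psi j (sm c x) = sm c (Psi j x)"
proof -
  have "gr_mult (gr_Psi j) (gr_const c) = gr_mult (gr_const c) (gr_Psi j)"
    unfolding gr_const_mult gr_Psi_mult using units_nz[OF assms(1)]
    by (auto simp: gr_const_def gr_Psi_def)
  then show ?thesis
    using act_gr_mult[of "gr_Psi j" "gr_const c" x] act_gr_mult[of "gr_const c" "gr_Psi j" x] assms
    by (simp add: zsmul_def)
qed

lemma Psi_mult:
  assumes "i \<in> zloc_units p" "j \<in> zloc_units p" shows "Psi (i * j) x = Psi i (Psi j x)"
proof -
  have "gr_mult (gr_Psi i) (gr_Psi j) = gr_Psi (i * j)"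
    unfolding gr_Psi_mult using units_nz[OF assms(1)] by (auto simp: gr_Psi_def field_simps)
  then show ?thesis using act_gr_mult[of "gr_Psi i" "gr_Psi j" x] assms by simp
qed

section \<open>Evaluation of polynomials at the operation \<open>Psi^q\<close>\<close>

definition poly_act :: "rat poly \<Rightarrow> 'm \<Rightarrow> 'm" where
  "poly_act P x = (\<Sum>i\<le>degree P. sm (coeff P i) (Psi (of_int q ^ i) x))"

lemma poly_act_eq: "degree P \<le> n \<Longrightarrow> poly_act P x = (\<Sum>i\<le>n. sm (coeff P i) (Psi (of_int q ^ i) x))"
  unfolding poly_act_def by (intro sum.mono_neutral_left) (auto simp: coeff_eq_0)

lemma q_pow_unit [simp, intro]: "of_int q ^ n \<in> zloc_units p"
  using q_unit by (rule units_power)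

lemma poly_act_0 [simp]: "poly_act 0 x = 0"
  by (simp add: poly_act_def)

lemma poly_act_add_left:
  assumes "P \<in> zpoly" "Q \<in> zpoly" shows "poly_act (P + Q) x = poly_act P x + poly_act Q x"
proof -
  let ?n = "max (degree P) (degree Q)"
  have "poly_act (P + Q) x = (\<Sum>i\<le>?n. sm (coeff P i) (Psi (of_int q ^ i) x) + sm (coeff Q i) (Psi (of_int q ^ i) x))"
    using assms zpolyD by (subst poly_act_eq[OF degree_add_le_max]) (simp add: s_add_left)
  also have "\<dots> = poly_act P x + poly_act Q x"
    by (simp add: sum.distrib poly_act_eq[of P ?n] poly_act_eq[of Q ?n])
  finally show ?thesis .
qed

lemma poly_act_smult:
  assumes "P \<in> zpoly" "c \<in> zloc p" shows "poly_act (smult c P) x = sm c (poly_act P x)"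
  using assms zpolyD by (subst poly_act_eq[OF degree_smult_le]) (simp add: poly_act_def s_sum s_mult)

lemma poly_act_pCons:
  assumes "P \<in> zpoly" shows "poly_act (pCons a P) x = sm a x + Psi (of_int q) (poly_act P x)"
proof -
  have "poly_act (pCons a P) x = (\<Sum>i\<le>Suc (degree P). sm (coeff (pCons a P) i) (Psi (of_int q ^ i) x))"
    by (rule poly_act_eq) (rule degree_pCons_le)
  also have "\<dots> = sm a x + (\<Sum>i\<le>degree P. sm (coeff P i) (Psi (of_int q ^ Suc i) x))"
    by (subst sum.atMost_Suc_shift) simp
  also have "(\<Sum>i\<le>degree P. sm (coeff P i) (Psi (of_int q ^ Suc i) x)) = Psi (of_int q) (poly_act P x)"
    unfolding poly_act_def Psi_sum[OF q_unit]
    using assms zpolyD by (simp add: Psi_sm q_unit Psi_mult)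
  finally show ?thesis .
qed

lemma poly_act_uminus_left: "P \<in> zpoly \<Longrightarrow> poly_act (- P) x = - poly_act P x"
  using poly_act_smult[of P "- 1" x] by (simp add: s_minus_left)

lemma poly_act_diff_left: "P \<in> zpoly \<Longrightarrow> Q \<in> zpoly \<Longrightarrow> poly_act (P - Q) x = poly_act P x - poly_act Q x"
  using poly_act_add_left[of P "- Q" x] by (simp add: poly_act_uminus_left)

lemma poly_act_1 [simp]: "poly_act 1 x = x"
  by (simp add: one_pCons poly_act_pCons Psi_0 q_unit)

lemma poly_act_add: "P \<in> zpoly \<Longrightarrow> poly_act P (x + y) = poly_act P x + poly_act P y"
  by (induction P) (simp_all add: poly_act_pCons s_add Psi_add q_unit)

lemma poly_act_zero [simp]: "P \<in> zpoly \<Longrightarrow> poly_act P 0 = 0"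
  using poly_act_add[of P 0 0] by simp

lemma poly_act_sum: "P \<in> zpoly \<Longrightarrow> poly_act P (\<Sum>i\<in>I. f i) = (\<Sum>i\<in>I. poly_act P (f i))"
  by (induction I rule: infinite_finite_induct) (simp_all add: poly_act_add)

lemma poly_act_sm: "P \<in> zpoly \<Longrightarrow> c \<in> zloc p \<Longrightarrow> poly_act P (sm c x) = sm c (poly_act P x)"
proof (induction P)
  case (pCons a P)
  then show ?case
    using s_mult[of a c x] s_mult[of c a x]
    by (simp add: poly_act_pCons s_add Psi_sm q_unit mult.commute)
qed simp

lemma poly_act_mult: "P \<in> zpoly \<Longrightarrow> Q \<in> zpoly \<Longrightarrow> poly_act (P * Q) x = poly_act P (poly_act Q x)"
proof (induction P)
  case (pCons a P)
  then have "poly_act (pCons a P * Q) x = poly_act (smult a Q) x + poly_act (pCons 0 (P * Q)) x"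
    by (simp add: poly_act_add_left)
  then show ?case using pCons by (simp add: poly_act_pCons poly_act_smult)
qed simp

lemma poly_act_commute: "P \<in> zpoly \<Longrightarrow> Q \<in> zpoly \<Longrightarrow> poly_act P (poly_act Q x) = poly_act Q (poly_act P x)"
  using poly_act_mult[of P Q x] poly_act_mult[of Q P x] by (simp add: mult.commute)

lemma poly_act_monom: "poly_act (monom 1 n) x = Psi (of_int q ^ n) x"
proof -
  have "poly_act (monom 1 n) x = (\<Sum>i\<le>n. sm (if n = i then 1 else 0) (Psi (of_int q ^ i) x))"
    by (subst poly_act_eq[OF degree_monom_le]) simp
  also have "\<dots> = (\<Sum>i\<le>n. if i = n then Psi (of_int q ^ n) x else 0)"
    by (rule sum.cong) auto
  finally show ?thesis by simp
qed

section \<open>The cyclic submodule generated by an element\<close>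

abbreviation Rx :: "'m \<Rightarrow> 'm set" where "Rx x \<equiv> cyclic_sub p actR x"

lemma RxI: "r \<in> grp_ring p \<Longrightarrow> actR r x \<in> Rx x"
  unfolding cyclic_sub_def by blast

lemma RxE:
  assumes "y \<in> Rx x"
  obtains r where "r \<in> grp_ring p" "y = actR r x"
  using assms unfolding cyclic_sub_def by blast

lemma Rx_self: "x \<in> Rx x"
  using RxI[OF gr_Psi_in[OF units_1], of x] by simp

lemma Rx_add:
  assumes "y \<in> Rx x" "z \<in> Rx x" shows "y + z \<in> Rx x"
proof -
  obtain r where r: "r \<in> grp_ring p" "y = actR r x" using assms(1) by (rule RxE)
  obtain t where t: "t \<in> grp_ring p" "z = actR t x" using assms(2) by (rule RxE)
  show ?thesis using RxI[OF gr_add_in[OF r(1) t(1)], of x] r t by (simp add: act_gr_add)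
qed

lemma Rx_sm:
  assumes "y \<in> Rx x" "c \<in> zloc p" shows "sm c y \<in> Rx x"
proof -
  obtain r where r: "r \<in> grp_ring p" "y = actR r x" using assms(1) by (rule RxE)
  show ?thesis
    using RxI[OF gr_const_mult_in[OF assms(2) r(1)], of x] r assms by (simp add: act_gr_mult zsmul_def)
qed

lemma Rx_Psi:
  assumes "y \<in> Rx x" "j \<in> zloc_units p" shows "Psi j y \<in> Rx x"
proof -
  obtain r where r: "r \<in> grp_ring p" "y = actR r x" using assms(1) by (rule RxE)
  show ?thesis
    using RxI[OF gr_Psi_mult_in[OF assms(2) r(1)], of x] r assms by (simp add: act_gr_mult)
qed

lemma Rx_0: "0 \<in> Rx x"
  using Rx_sm[OF Rx_self, of 0 x] by simp

lemma Rx_diff: "y \<in> Rx x \<Longrightarrow> z \<in> Rx x \<Longrightarrow> y - z \<in> Rx x"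
  using Rx_add[of y x "sm (- 1) z"] Rx_sm[of z x "- 1"] by (simp add: s_minus_left)

lemma Rx_poly_act: "y \<in> Rx x \<Longrightarrow> P \<in> zpoly \<Longrightarrow> poly_act P y \<in> Rx x"
  by (induction P) (auto simp: poly_act_pCons intro: Rx_0 Rx_add Rx_sm Rx_Psi q_unit)

lemma Rx_gspan: "\<exists>G. finite G \<and> Rx x = gspan G (\<lambda>g. g)"
  using bous(1)[of x] unfolding bous_a_def gspan_def by blast

lemma Rx_krull: "y \<in> Rx x \<Longrightarrow> (\<And>m. \<exists>z\<in>Rx x. y = sm (of_nat p ^ m) z) \<Longrightarrow> y = 0"
  using Rx_gspan[of x] gspan_krull[of _ y "\<lambda>g. g"] by metis

section \<open>Annihilation of each element by a product of factors
  \<open>Psi^q - q^k\<close>\<close>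

lemma torsion_add:
  assumes "torsion_el actR y" "torsion_el actR z" shows "torsion_el actR (y + z)"
proof -
  obtain M N :: int where MN: "M \<noteq> 0" "N \<noteq> 0" "sm (of_int M) y = 0" "sm (of_int N) z = 0"
    using assms unfolding torsion_el_def by blast
  have "sm (of_int (N * M)) y = 0" "sm (of_int (M * N)) z = 0"
    using MN by (simp_all add: s_mult)
  then have "sm (of_int (M * N)) (y + z) = 0" by (simp add: s_add mult.commute)
  then show ?thesis unfolding torsion_el_def using MN by (metis mult_eq_0_iff)
qed

lemma torsion_0: "torsion_el actR 0"
  unfolding torsion_el_def by (intro exI[of _ 1]) simp

lemma torsion_sum: "(\<And>i. i \<in> I \<Longrightarrow> torsion_el actR (f i)) \<Longrightarrow> torsion_el actR (\<Sum>i\<in>I. f i)"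
  by (induction I rule: infinite_finite_induct) (auto intro: torsion_add torsion_0)

lemma torsion_poly_act:
  assumes "torsion_el actR y" "P \<in> zpoly" shows "torsion_el actR (poly_act P y)"
proof -
  obtain N :: int where N: "N \<noteq> 0" "sm (of_int N) y = 0"
    using assms unfolding torsion_el_def by blast
  then have "sm (of_int N) (poly_act P y) = 0"
    using poly_act_sm[of P "of_int N" y] assms by simp
  then show ?thesis unfolding torsion_el_def using N by blast
qed

text \<open>Condition (b) for \<open>j = q\<close> writes a nonzero multiple of \<open>x\<close>, up
  to torsion, as a sum of eigenvectors. The factor belonging to its eigenvalue sends an eigenvector
  to torsion, and the remaining factors preserve torsion.\<close>

lemma vanish_poly_torsion: "\<exists>K. finite K \<and> torsion_el actR (poly_act (vanish_poly K) x)"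
proof -
  obtain N :: int and n ys ks where N: "N \<noteq> 0"
    "\<And>i::nat. i < n \<Longrightarrow> torsion_el actR (Psi (of_int q) (ys i) - sm (of_int q powi ks i) (ys i))"
    "torsion_el actR (sm (of_int N) x - (\<Sum>i<n. ys i))"
    using bous(2)[of x] q_unit Rx_self unfolding bous_b_def by metis
  define K where "K = ks ` {..<n}"
  have "torsion_el actR (poly_act (vanish_poly K) (ys i))" if i: "i < n" for i
  proof -
    have K: "finite K" "ks i \<in> K" using i by (auto simp: K_def)
    let ?F = "[:- (of_int q powi ks i), 1:]"
    have TK: "vanish_poly K = vanish_poly (K - {ks i}) * ?F"
      unfolding vanish_poly_def using K by (subst prod.remove[of K "ks i"]) (simp_all add: mult.commute)
    have F: "?F \<in> zpoly" by simp
    have "poly_act ?F (ys i) = Psi (of_int q) (ys i) - sm (of_int q powi ks i) (ys i)"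
      by (simp add: poly_act_pCons s_minus_left Psi_0 q_unit)
    then show ?thesis
      unfolding TK using N(2)[OF i] poly_act_mult[OF vanish_poly_zpoly F] torsion_poly_act vanish_poly_zpoly by metis
  qed
  then have "torsion_el actR (poly_act (vanish_poly K) (\<Sum>i<n. ys i))"
    by (auto simp: poly_act_sum intro: torsion_sum)
  then have "torsion_el actR (poly_act (vanish_poly K) (sm (of_int N) x - (\<Sum>i<n. ys i)) + poly_act (vanish_poly K) (\<Sum>i<n. ys i))"
    using torsion_poly_act[OF N(3) vanish_poly_zpoly] by (intro torsion_add)
  then have "torsion_el actR (sm (of_int N) (poly_act (vanish_poly K) x))"
    by (simp add: poly_act_add[symmetric] poly_act_sm)
  then obtain M :: int where M: "M \<noteq> 0" "sm (of_int M) (sm (of_int N) (poly_act (vanish_poly K) x)) = 0"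
    unfolding torsion_el_def by blast
  then have "sm (of_int (M * N)) (poly_act (vanish_poly K) x) = 0" by (simp add: s_mult)
  then have "torsion_el actR (poly_act (vanish_poly K) x)"
    unfolding torsion_el_def using M N by (metis mult_eq_0_iff)
  then show ?thesis unfolding K_def by blast
qed

lemma poly_act_pcong:
  assumes "pcong P Q" "P \<in> zpoly" "Q \<in> zpoly" "y \<in> Rx x"
  shows "\<exists>w\<in>Rx x. poly_act P y - poly_act Q y = sm (of_nat p) w"
proof -
  obtain E where E: "E \<in> zpoly" "P - Q = smult (of_nat p) E"
    using assms unfolding pcong_def by blast
  have "poly_act P y - poly_act Q y = poly_act (smult (of_nat p) E) y"
    using assms E by (metis poly_act_diff_left)
  then show ?thesis using E Rx_poly_act[OF assms(4)] by (auto simp: poly_act_smult)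
qed

text \<open>Modulo \<open>p\<close> the window of length \<open>t\<close> is \<open>X^t - 1\<close>,
  and by (c) \<open>Psi^(q^t)\<close> is the identity on \<open>Rx / p Rx\<close> once
  \<open>q^t\<close> is close enough to 1. The same \<open>t\<close> serves all starting points,
  which lets windows be concatenated.\<close>

lemma window_mod_p:
  "\<exists>t. \<forall>l. \<forall>y\<in>Rx x. \<exists>w\<in>Rx x. poly_act (window l t) y = sm (of_nat p) w"
proof -
  obtain k where k: "\<And>j j' y. j \<in> zloc_units p \<Longrightarrow> j' \<in> zloc_units p \<Longrightarrow>
      (j - j') / of_nat (p ^ k) \<in> zloc p \<Longrightarrow> y \<in> Rx x \<Longrightarrow>
      \<exists>z\<in>Rx x. Psi j y - Psi j' y = sm (of_nat (p ^ 1)) z"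
    using bous(3)[of x] unfolding bous_c_def by (metis le_refl)
  \<comment> \<open>With \<open>p^k\<close> the modulus that (c) gives for \<open>m = 1\<close>,
    this exponent makes \<open>q^t\<close> congruent to 1 even modulo
    \<open>p^(k+1)\<close>.\<close>
  define t where "t = (p - 1) * p ^ k"
  have "int p ^ k dvd q ^ t - 1"
    using q_euler[of k] unfolding t_def by (metis dvd_trans le_imp_power_dvd lessI less_imp_le)
  then have qt: "(of_int q ^ t - 1) / of_nat (p ^ k) \<in> zloc p"
    using zloc_dvd_of_int[of k "q ^ t - 1"] by simp
  have "\<exists>w\<in>Rx x. poly_act (window l t) y = sm (of_nat p) w" if y: "y \<in> Rx x" for l y
  proof -
    obtain w where w: "w \<in> Rx x" "poly_act (window l t) y - poly_act (monom 1 t - 1) y = sm (of_nat p) w"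
      using poly_act_pcong[OF window_frobenius[of l k] _ _ y] unfolding t_def by auto
    obtain z where z: "z \<in> Rx x" "Psi (of_int q ^ t) y - Psi 1 y = sm (of_nat (p ^ 1)) z"
      using k[OF q_pow_unit units_1 qt y] by blast
    have "poly_act (monom 1 t - 1) y = sm (of_nat p) z"
      using z(2) by (simp add: poly_act_diff_left poly_act_monom)
    then have "poly_act (window l t) y = sm (of_nat p) (w + z)"
      using w(2) by (simp add: s_add algebra_simps)
    then show ?thesis using Rx_add w z by blast
  qed
  then show ?thesis by blast
qed

text \<open>Each of \<open>m\<close> consecutive windows maps \<open>Rx\<close> into
  \<open>p Rx\<close> and commutes with scalars, so each contributes one factor
  \<open>p\<close>.\<close>

lemma vanish_poly_mod_p_power: "\<exists>K. finite K \<and> (\<forall>y\<in>Rx x. \<exists>w\<in>Rx x. poly_act (vanish_poly K) y = sm (of_nat p ^ m) w)"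
proof -
  obtain t where t: "\<And>l y. y \<in> Rx x \<Longrightarrow> \<exists>w\<in>Rx x. poly_act (window l t) y = sm (of_nat p) w"
    using window_mod_p by blast
  have "\<exists>w\<in>Rx x. poly_act (window l (m * t)) y = sm (of_nat p ^ m) w" if "y \<in> Rx x" for l y
    using that
  proof (induction m arbitrary: l y)
    case 0
    then show ?case by (auto simp: window_def)
  next
    case (Suc m)
    obtain w where w: "w \<in> Rx x" "poly_act (window (l + t) (m * t)) y = sm (of_nat p ^ m) w"
      using Suc by blast
    obtain v where v: "v \<in> Rx x" "poly_act (window l t) w = sm (of_nat p) v"
      using t w by blast
    have "poly_act (window l (Suc m * t)) y = poly_act (window l t) (sm (of_nat p ^ m) w)"
      using w by (simp add: window_add poly_act_mult)
    also have "\<dots> = sm (of_nat p ^ m) (sm (of_nat p) v)"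
      using v by (simp add: poly_act_sm)
    also have "\<dots> = sm (of_nat p ^ Suc m) v"
      by (simp add: s_mult[symmetric] mult.commute)
    finally show ?case using v by blast
  qed
  then have "\<forall>y\<in>Rx x. \<exists>w\<in>Rx x. poly_act (vanish_poly (int ` {..<m * t})) y = sm (of_nat p ^ m) w"
    unfolding vanish_poly_window by blast
  then show ?thesis by blast
qed

text \<open>The factors from \<open>K\<close> make the image torsion and those from
  \<open>K'\<close> move it into \<open>p^e Rx\<close>; with \<open>e\<close> obtained from
  condition (a), the only torsion there is 0.\<close>

lemma vanish_poly_kills: "\<exists>K. finite K \<and> poly_act (vanish_poly K) x = 0"
proof -
  obtain G where G: "finite G" "Rx x = gspan G (\<lambda>g. g)" using Rx_gspan by blast
  obtain e where e: "\<And>z K. z \<in> Rx x \<Longrightarrow> K \<noteq> (0::int) \<Longrightarrow> sm (of_int K) (sm (of_nat p ^ e) z) = 0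
      \<Longrightarrow> sm (of_nat p ^ e) z = 0"
    using gspan_torsion[OF G(1)] unfolding G(2) by metis
  obtain K where K: "finite K" "torsion_el actR (poly_act (vanish_poly K) x)" using vanish_poly_torsion by blast
  obtain K' where K': "finite K'" "\<And>y. y \<in> Rx x \<Longrightarrow> \<exists>w\<in>Rx x. poly_act (vanish_poly K') y = sm (of_nat p ^ e) w"
    using vanish_poly_mod_p_power[of x e] by blast
  obtain w where w: "w \<in> Rx x" "poly_act (vanish_poly K') x = sm (of_nat p ^ e) w"
    using K'(2)[OF Rx_self] by blast
  \<comment> \<open>The product over the union is factored in two ways: through \<open>K'\<close> to
    see divisibility by \<open>p^e\<close>, and further below through \<open>K\<close> to see
    torsion.\<close>
  have "poly_act (vanish_poly (K \<union> K')) x = poly_act (vanish_poly (K - K')) (sm (of_nat p ^ e) w)"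
    using w vanish_poly_Un[OF K'(1) K(1)] by (simp add: Un_commute poly_act_mult)
  then have 1: "poly_act (vanish_poly (K \<union> K')) x = sm (of_nat p ^ e) (poly_act (vanish_poly (K - K')) w)"
    by (simp add: poly_act_sm)
  have "torsion_el actR (poly_act (vanish_poly (K \<union> K')) x)"
    unfolding vanish_poly_Un[OF K(1) K'(1)] using K(2) by (simp add: poly_act_mult torsion_poly_act)
  then have "poly_act (vanish_poly (K \<union> K')) x = 0"
    unfolding 1 torsion_el_def using e Rx_poly_act[OF w(1) vanish_poly_zpoly] by blast
  then show ?thesis using K K' by blast
qed

end

section \<open>The extended action\<close>

text \<open>Enumerates the integers as 0, 1, -1, 2, -2, ... for \<open>i = 1, 2, ...\<close>;
  \<open>q_seq q i\<close> is \<open>q\<close> to this power.\<close>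

definition q_exponent :: "nat \<Rightarrow> int" where
  "q_exponent i = (- 1) ^ i * \<lfloor>real i / 2\<rfloor>"

lemma q_exponent_eq: "q_exponent i = (if even i then int (i div 2) else - int (i div 2))"
  using floor_divide_of_nat_eq[of i 2, where ?'a = real] by (simp add: q_exponent_def)

definition exponents :: "nat \<Rightarrow> int set" where
  "exponents n = q_exponent ` {1..n}"

lemma finite_exponents [simp, intro]: "finite (exponents n)"
  by (simp add: exponents_def)

lemma exponents_mono: "m \<le> n \<Longrightarrow> exponents m \<subseteq> exponents n"
  by (auto simp: exponents_def)

lemma inj_q_exponent: "inj_on q_exponent {1..n}"
proof (rule inj_onI)
  fix i j assume "i \<in> {1..n}" "j \<in> {1..n}" "q_exponent i = q_exponent j"
  then have "i \<ge> 1" "j \<ge> 1" "q_exponent i = q_exponent j" by auto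
  then show "i = j"
    unfolding q_exponent_eq by (cases "even i"; cases "even j") (auto elim!: evenE oddE)
qed

text \<open>A positive \<open>k\<close> has index \<open>2 k\<close>, any other \<open>k\<close> has
  index \<open>2 |k| + 1\<close>; the sum over \<open>K\<close> merely bounds all these
  indices.\<close>

lemma exponents_covers:
  assumes "finite K" shows "\<exists>n. K \<subseteq> exponents n"
proof -
  have mem: "k \<in> exponents (2 * nat \<bar>k\<bar> + 1)" for k
  proof (cases "k > 0")
    case True
    then have "q_exponent (2 * nat k) = k" "2 * nat k \<in> {1..2 * nat \<bar>k\<bar> + 1}" by (auto simp: q_exponent_eq)
    then show ?thesis unfolding exponents_def by (metis imageI)
  next
    case False
    then have "q_exponent (2 * nat (- k) + 1) = k" "2 * nat (- k) + 1 \<in> {1..2 * nat \<bar>k\<bar> + 1}"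
      by (auto simp: q_exponent_eq)
    then show ?thesis unfolding exponents_def by (metis imageI)
  qed
  have "k \<in> exponents (\<Sum>k\<in>K. 2 * nat \<bar>k\<bar> + 1)" if k: "k \<in> K" for k
  proof -
    have "2 * nat \<bar>k\<bar> + 1 \<le> (\<Sum>k\<in>K. 2 * nat \<bar>k\<bar> + 1)"
      using assms k by (intro member_le_sum[of k K "\<lambda>k. 2 * nat \<bar>k\<bar> + 1"]) auto
    then show ?thesis using mem[of k] exponents_mono by blast
  qed
  then show ?thesis by blast
qed

section \<open>Operations as functions of the exponent\<close>

context primroot
begin

lemma Theta_eq: "Theta q n X = poly (vanish_poly (exponents n)) X"
  unfolding Theta_def poly_vanish_poly exponents_def q_seq_def
  by (subst prod.reindex[OF inj_q_exponent]) (simp add: q_exponent_def)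

text \<open>From \<open>m = n\<close> on, \<open>Theta_m\<close> has \<open>q^k\<close> among its
  roots; this is what makes the infinite sum converge.\<close>

lemma Phi_sum_eq:
  assumes "k \<in> exponents n"
  shows "Phi_sum q a k = (\<Sum>m<n. a m * poly (vanish_poly (exponents m)) (of_int q powi k))"
proof -
  have 0: "poly (vanish_poly (exponents m)) (of_int q powi k) = 0" if "n \<le> m" for m
    using that assms exponents_mono poly_vanish_poly_eq_0_iff[OF finite_exponents] by blast
  then have sub: "{m. a m * Theta q m (of_int q powi k) \<noteq> 0} \<subseteq> {..<n}"
    unfolding Theta_eq by (auto simp: not_le[symmetric])
  show ?thesis unfolding Phi_sum_def
    by (rule sum.mono_neutral_cong_left) (use sub in \<open>auto simp: Theta_eq\<close>)
qed

definition partial_poly :: "(nat \<Rightarrow> rat) \<Rightarrow> nat \<Rightarrow> rat poly" where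
  "partial_poly a n = (\<Sum>m<n. smult (a m) (vanish_poly (exponents m)))"

lemma partial_poly_zpoly: "(\<And>m. a m \<in> zloc p) \<Longrightarrow> partial_poly a n \<in> zpoly"
  unfolding partial_poly_def by (intro zpoly_sum) auto

lemma poly_partial_poly: "k \<in> exponents n \<Longrightarrow> poly (partial_poly a n) (of_int q powi k) = Phi_sum q a k"
  by (simp add: Phi_sum_eq partial_poly_def poly_sum)

text \<open>Cutting off the series leaves a polynomial in \<open>Psi^q\<close>, hence an operation
  coming from \<open>R\<close>; uniqueness rests on this.\<close>

lemma Phi_sum_truncate:
  "Phi_sum q (\<lambda>m. if m < n then a m else 0) = (\<lambda>k. poly (partial_poly a n) (of_int q powi k))"
proof
  fix k
  obtain N where N: "k \<in> exponents N" using exponents_covers[of "{k}"] by auto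
  \<comment> \<open>The bound \<open>n + N\<close> covers both the evaluation point \<open>k\<close>
    and all nonzero coefficients.\<close>
  then have "k \<in> exponents (n + N)" using exponents_mono[of N "n + N"] by auto
  then have "Phi_sum q (\<lambda>m. if m < n then a m else 0) k
      = (\<Sum>m<n + N. (if m < n then a m else 0) * poly (vanish_poly (exponents m)) (of_int q powi k))"
    by (rule Phi_sum_eq)
  also have "\<dots> = (\<Sum>m<n. a m * poly (vanish_poly (exponents m)) (of_int q powi k))"
    by (rule sum.mono_neutral_cong_right) auto
  finally show "Phi_sum q (\<lambda>m. if m < n then a m else 0) k = poly (partial_poly a n) (of_int q powi k)"
    by (simp add: partial_poly_def poly_sum)
qed

lemma Phi_sum_add: "Phi_sum q (\<lambda>m. a m + b m) = (\<lambda>k. Phi_sum q a k + Phi_sum q b k)"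
proof
  fix k
  obtain N where "k \<in> exponents N" using exponents_covers[of "{k}"] by auto
  then show "Phi_sum q (\<lambda>m. a m + b m) k = Phi_sum q a k + Phi_sum q b k"
    by (simp add: Phi_sum_eq sum.distrib algebra_simps)
qed

text \<open>What the construction of the action requires of an operation. The property passes to
  pointwise sums and products and will be shown for \<open>R_to_A r\<close>, so these can be handled
  without computing their expansions in the \<open>Phi_n\<close>.\<close>

definition interpolable :: "(int \<Rightarrow> rat) \<Rightarrow> bool" where
  "interpolable f \<longleftrightarrow> (\<forall>K. finite K \<longrightarrow> (\<exists>P\<in>zpoly. \<forall>k\<in>K. poly P (of_int q powi k) = f k))"

lemma interpolableD:
  assumes "interpolable f" "finite K"
  obtains P where "P \<in> zpoly" "\<And>k. k \<in> K \<Longrightarrow> poly P (of_int q powi k) = f k"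
proof -
  have "\<exists>P\<in>zpoly. \<forall>k\<in>K. poly P (of_int q powi k) = f k"
    using assms by (simp add: interpolable_def)
  then show thesis using that by blast
qed

lemma interpolable_A_ring:
  assumes "f \<in> A_ring p q" shows "interpolable f"
  unfolding interpolable_def
proof (intro allI impI)
  fix K :: "int set" assume "finite K"
  then obtain n where n: "K \<subseteq> exponents n" using exponents_covers by blast
  obtain a where a: "\<And>m. a m \<in> zloc p" "f = Phi_sum q a"
    using assms unfolding A_ring_def A_filt_def by blast
  show "\<exists>P\<in>zpoly. \<forall>k\<in>K. poly P (of_int q powi k) = f k"
    using n a poly_partial_poly by (intro bexI[of _ "partial_poly a n"] partial_poly_zpoly) auto
qed

lemma interpolable_add:
  assumes "interpolable f" "interpolable g" shows "interpolable (\<lambda>k. f k + g k)"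
  unfolding interpolable_def
proof (intro allI impI)
  fix K :: "int set" assume K: "finite K"
  obtain P where P: "P \<in> zpoly" "\<And>k. k \<in> K \<Longrightarrow> poly P (of_int q powi k) = f k"
    using interpolableD[OF assms(1) K] by blast
  obtain Q where Q: "Q \<in> zpoly" "\<And>k. k \<in> K \<Longrightarrow> poly Q (of_int q powi k) = g k"
    using interpolableD[OF assms(2) K] by blast
  show "\<exists>P\<in>zpoly. \<forall>k\<in>K. poly P (of_int q powi k) = f k + g k"
    using P Q by (intro bexI[of _ "P + Q"]) auto
qed

lemma interpolable_mult:
  assumes "interpolable f" "interpolable g" shows "interpolable (\<lambda>k. f k * g k)"
  unfolding interpolable_def
proof (intro allI impI)
  fix K :: "int set" assume K: "finite K"
  obtain P where P: "P \<in> zpoly" "\<And>k. k \<in> K \<Longrightarrow> poly P (of_int q powi k) = f k"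
    using interpolableD[OF assms(1) K] by blast
  obtain Q where Q: "Q \<in> zpoly" "\<And>k. k \<in> K \<Longrightarrow> poly Q (of_int q powi k) = g k"
    using interpolableD[OF assms(2) K] by blast
  show "\<exists>P\<in>zpoly. \<forall>k\<in>K. poly P (of_int q powi k) = f k * g k"
    using P Q by (intro bexI[of _ "P * Q"]) auto
qed

lemma interpolable_1: "interpolable (\<lambda>k. 1)"
  unfolding interpolable_def by (auto intro!: bexI[of _ 1])

text \<open>Since \<open>j\<close> is \<open>p\<close>-adically close to some \<open>q\<^sup>s\<close>, the function \<open>k \<mapsto> j\<^sup>k\<close> differs on \<open>K\<close> from the
  polynomial \<open>X\<^sup>s\<close> by values of high \<open>p\<close>-divisibility, which Newton interpolation can absorb.\<close>

lemma interp_unit_power: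
  assumes j: "j \<in> zloc_units p" and K: "finite K"
  obtains t C where "C \<in> zpoly" "(j - of_int q ^ t) / of_nat p ^ e \<in> zloc p"
    "\<And>k. k \<in> K \<Longrightarrow> poly (monom 1 t + smult (of_nat p ^ m) C) (of_int q powi k) = j powi k"
proof -
  obtain D where D: "\<And>v. (\<forall>k\<in>K. v k \<in> zloc p) \<Longrightarrow>
      \<exists>P\<in>zpoly. \<forall>k\<in>K. poly P (of_int q powi k) = of_nat p ^ D * v k"
    using interpolation[OF K] by blast
  have weaken: "y / of_nat p ^ a \<in> zloc p" if "y / of_nat p ^ (a + b) \<in> zloc p" for y a b
  proof -
    have "y / of_nat p ^ a = of_nat p ^ b * (y / of_nat p ^ (a + b))"
      using p_nz by (simp add: power_add)
    moreover have "of_nat p ^ b * (y / of_nat p ^ (a + b)) \<in> zloc p"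
      by (rule zloc_mult) (use that in auto)
    ultimately show ?thesis by (simp only:)
  qed
  \<comment> \<open>Three demands on the closeness: \<open>e\<close> is requested from outside,
    \<open>D\<close> pays for the interpolation, and \<open>m\<close> remains as the divisibility of
    the correction.\<close>
  obtain t where t: "(j - of_int q ^ t) / of_nat p ^ (e + (D + m)) \<in> zloc p"
    using q_density[OF j] by blast
  define v where "v k = (j powi k - (of_int q ^ t) powi k) / of_nat p ^ (D + m)" for k
  have "(j - of_int q ^ t) / of_nat p ^ (D + m) \<in> zloc p"
    by (rule weaken[of _ _ e]) (use t in \<open>simp add: add.commute\<close>)
  then have "v k \<in> zloc p" for k
    unfolding v_def by (intro zloc_powi_cong j units_power q_unit)
  then obtain C where C: "C \<in> zpoly" "\<And>k. k \<in> K \<Longrightarrow> poly C (of_int q powi k) = of_nat p ^ D * v k"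
    using D[of v] by blast
  have "poly (monom 1 t + smult (of_nat p ^ m) C) (of_int q powi k) = j powi k" if k: "k \<in> K" for k
  proof -
    have "poly (monom 1 t + smult (of_nat p ^ m) C) (of_int q powi k)
        = (of_int q powi k) ^ t + of_nat p ^ m * (of_nat p ^ D * v k)"
      by (simp add: poly_monom C(2)[OF k])
    also have "(of_int q powi k :: rat) ^ t = (of_int q ^ t) powi k"
      by (simp add: power_int_power power_int_power' mult.commute)
    also have "of_nat p ^ m * (of_nat p ^ D * v k) = j powi k - (of_int q ^ t) powi k"
      using p_nz by (auto simp: v_def power_add)
    finally show ?thesis by simp
  qed
  then show thesis using that[OF C(1) weaken[OF t]] by blast
qed

end

section \<open>Construction of the action of \<open>A\<close> and its discreteness\<close>

context bousfield
begin

lemma vanish_poly_kills_mono: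
  assumes "poly_act (vanish_poly K) x = 0" "K \<subseteq> K'" "finite K'" shows "poly_act (vanish_poly K') x = 0"
proof -
  have "vanish_poly K' = vanish_poly (K' - K) * vanish_poly K"
    using vanish_poly_Un[of K K'] assms finite_subset by (metis Un_absorb1)
  then show ?thesis using assms by (simp add: poly_act_mult)
qed

text \<open>The difference \<open>P - P'\<close> is a multiple of \<open>vanish_poly K\<close>,
  which kills \<open>x\<close>.\<close>

lemma poly_act_agree:
  assumes "finite K" "poly_act (vanish_poly K) x = 0" "P \<in> zpoly" "P' \<in> zpoly"
    "\<And>k. k \<in> K \<Longrightarrow> poly P (of_int q powi k) = poly P' (of_int q powi k)"
  shows "poly_act P x = poly_act P' x"
proof -
  obtain Q where Q: "Q \<in> zpoly" "P - P' = Q * vanish_poly K"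
    using vanish_poly_divides[of K "P - P'"] assms by auto
  have "poly_act P x - poly_act P' x = poly_act (Q * vanish_poly K) x"
    using assms Q by (metis poly_act_diff_left)
  then show ?thesis using Q assms by (simp add: poly_act_mult)
qed

text \<open>Any interpolant on any killing set of exponents may be chosen; \<open>actA_eq\<close>
  shows that for interpolable \<open>f\<close> the choice is immaterial.\<close>

definition actA :: "(int \<Rightarrow> rat) \<Rightarrow> 'm \<Rightarrow> 'm" where
  "actA f x = (SOME y. \<exists>K P. finite K \<and> poly_act (vanish_poly K) x = 0 \<and> P \<in> zpoly \<and>
     (\<forall>k\<in>K. poly P (of_int q powi k) = f k) \<and> y = poly_act P x)"

lemma actA_eq:
  assumes f: "interpolable f" and K: "finite K" "poly_act (vanish_poly K) x = 0"
    and P: "P \<in> zpoly" "\<And>k. k \<in> K \<Longrightarrow> poly P (of_int q powi k) = f k"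
  shows "actA f x = poly_act P x"
proof -
  have uniq: "y = poly_act P x" if y: "\<exists>K P. finite K \<and> poly_act (vanish_poly K) x = 0 \<and> P \<in> zpoly \<and>
     (\<forall>k\<in>K. poly P (of_int q powi k) = f k) \<and> y = poly_act P x" for y
  proof -
    obtain K' P' where *: "finite K'" "poly_act (vanish_poly K') x = 0" "P' \<in> zpoly"
      "\<And>k. k \<in> K' \<Longrightarrow> poly P' (of_int q powi k) = f k" "y = poly_act P' x" using y by blast
    \<comment> \<open>Two choices are compared through an interpolant on the union of both exponent
      sets.\<close>
    have "finite (K \<union> K')" using K * by simp
    then obtain R where R: "R \<in> zpoly" "\<And>k. k \<in> K \<union> K' \<Longrightarrow> poly R (of_int q powi k) = f k"
      by (rule interpolableD[OF f]) blast
    have "poly_act P x = poly_act R x" by (rule poly_act_agree[OF K P(1) R(1)]) (simp add: P R)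
    also have "\<dots> = poly_act P' x" by (rule poly_act_agree[OF *(1,2) R(1) *(3)]) (simp add: * R)
    finally show ?thesis using * by simp
  qed
  show ?thesis
    unfolding actA_def
  proof (rule some_equality)
    show "\<exists>K P'. finite K \<and> poly_act (vanish_poly K) x = 0 \<and> P' \<in> zpoly \<and>
      (\<forall>k\<in>K. poly P' (of_int q powi k) = f k) \<and> poly_act P x = poly_act P' x"
      using K P by (intro exI[of _ K] exI[of _ P]) auto
  qed (rule uniq)
qed

lemma actA_obtain:
  assumes "interpolable f" "finite K" "poly_act (vanish_poly K) x = 0"
  obtains P where "P \<in> zpoly" "\<And>k. k \<in> K \<Longrightarrow> poly P (of_int q powi k) = f k" "actA f x = poly_act P x"
  using interpolableD[OF assms(1,2)] actA_eq[OF assms] by metis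

lemma discrete_actA: "discrete_A_module p q actA"
  unfolding discrete_A_module_def A_module_def ring_action_def
proof (intro conjI ballI allI)
  fix f x y assume "f \<in> A_ring p q"
  then have f: "interpolable f" by (rule interpolable_A_ring)
  obtain K where K: "finite K" "poly_act (vanish_poly K) x = 0" using vanish_poly_kills by blast
  obtain K' where K': "finite K'" "poly_act (vanish_poly K') y = 0" using vanish_poly_kills by blast
  \<comment> \<open>One killing set for both elements, so that a single polynomial computes all
    three values.\<close>
  have fin: "finite (K \<union> K')" using K K' by simp
  have x: "poly_act (vanish_poly (K \<union> K')) x = 0" and y: "poly_act (vanish_poly (K \<union> K')) y = 0"
    using vanish_poly_kills_mono[OF K(2) _ fin] vanish_poly_kills_mono[OF K'(2) _ fin] by auto
  then have xy: "poly_act (vanish_poly (K \<union> K')) (x + y) = 0" by (simp add: poly_act_add)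
  obtain P where P: "P \<in> zpoly" "\<And>k. k \<in> K \<union> K' \<Longrightarrow> poly P (of_int q powi k) = f k"
    using interpolableD[OF f fin] by blast
  have "actA f x = poly_act P x" "actA f y = poly_act P y" "actA f (x + y) = poly_act P (x + y)"
    by (rule actA_eq[OF f fin _ P]; use x y xy in simp)+
  then show "actA f (x + y) = actA f x + actA f y"
    using P by (simp add: poly_act_add)
next
  fix f g x assume "f \<in> A_ring p q" "g \<in> A_ring p q"
  then have fg: "interpolable f" "interpolable g" by (auto intro: interpolable_A_ring)
  obtain K where K: "finite K" "poly_act (vanish_poly K) x = 0" using vanish_poly_kills by blast
  obtain P where P: "P \<in> zpoly" "\<And>k. k \<in> K \<Longrightarrow> poly P (of_int q powi k) = f k" "actA f x = poly_act P x"
    using actA_obtain[OF fg(1) K] by blast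
  obtain Q where Q: "Q \<in> zpoly" "\<And>k. k \<in> K \<Longrightarrow> poly Q (of_int q powi k) = g k" "actA g x = poly_act Q x"
    using actA_obtain[OF fg(2) K] by blast
  have "actA (\<lambda>k. f k + g k) x = poly_act (P + Q) x"
    by (rule actA_eq[OF interpolable_add[OF fg] K]) (use P Q in auto)
  then show "actA (\<lambda>k. f k + g k) x = actA f x + actA g x"
    using P Q by (simp add: poly_act_add_left)
  have "actA (\<lambda>k. f k * g k) x = poly_act (P * Q) x"
    by (rule actA_eq[OF interpolable_mult[OF fg] K]) (use P Q in auto)
  \<comment> \<open>Polynomials in \<open>Psi^q\<close> commute, so the product that kills
    \<open>x\<close> also kills \<open>Q(Psi^q) x\<close>.\<close>
  moreover have "poly_act (vanish_poly K) (poly_act Q x) = 0"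
    using K Q poly_act_commute[OF vanish_poly_zpoly Q(1), of K x] by simp
  then have "actA f (poly_act Q x) = poly_act P (poly_act Q x)"
    by (rule actA_eq[OF fg(1) K(1)]) (use P in auto)
  ultimately show "actA (\<lambda>k. f k * g k) x = actA f (actA g x)"
    using P Q by (simp add: poly_act_mult)
next
  fix x
  obtain K where K: "finite K" "poly_act (vanish_poly K) x = 0" using vanish_poly_kills by blast
  show "actA (\<lambda>k. 1) x = x"
    using actA_eq[OF interpolable_1 K, of 1] by simp
next
  fix x
  obtain K where K: "finite K" "poly_act (vanish_poly K) x = 0" using vanish_poly_kills by blast
  obtain n where n: "K \<subseteq> exponents n" using exponents_covers[OF K(1)] by blast
  have kn: "poly_act (vanish_poly (exponents n)) x = 0" using vanish_poly_kills_mono[OF K(2) n] by simp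
  have "actA f x = 0" if f: "f \<in> A_filt p q n" for f
  proof -
    obtain a where a: "\<And>m. a m \<in> zloc p" "\<And>m. m < n \<Longrightarrow> a m = 0" "f = Phi_sum q a"
      using f unfolding A_filt_def by blast
    then have "f \<in> A_ring p q" unfolding A_ring_def A_filt_def by auto
    \<comment> \<open>An operation in \<open>A_n\<close> vanishes at the first \<open>n\<close>
      exponents, where it is therefore interpolated by 0.\<close>
    then have "actA f x = poly_act 0 x"
      by (intro actA_eq[OF interpolable_A_ring finite_exponents kn]) (auto simp: a Phi_sum_eq)
    then show ?thesis by simp
  qed
  then show "\<exists>n. \<forall>f\<in>A_filt p q n. actA f x = 0" by blast
qed

section \<open>Compatibility with the action of \<open>R\<close>\<close>

lemma poly_act_interp_unit_power:
  assumes j: "j \<in> zloc_units p" and K: "finite K" "poly_act (vanish_poly K) x = 0"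
  obtains P where "P \<in> zpoly" "\<And>k. k \<in> K \<Longrightarrow> poly P (of_int q powi k) = j powi k" "poly_act P x = Psi j x"
proof -
  \<comment> \<open>Any interpolant over the \<open>p\<close>-local integers will do here, so no
    divisibility or closeness is requested: \<open>m = 0\<close> and \<open>e = 0\<close>.\<close>
  obtain t0 C0 where C0: "C0 \<in> zpoly"
      "\<And>k. k \<in> K \<Longrightarrow> poly (monom 1 t0 + smult (of_nat p ^ 0) C0) (of_int q powi k) = j powi k"
    using interp_unit_power[OF j K(1), where m = 0 and e = 0] by metis
  define P where "P = monom 1 t0 + smult (of_nat p ^ 0) C0"
  have P: "P \<in> zpoly" "\<And>k. k \<in> K \<Longrightarrow> poly P (of_int q powi k) = j powi k"
    using C0 by (auto simp: P_def)
  \<comment> \<open>For every \<open>m >= 1\<close>, \<open>P\<close> acts on \<open>x\<close> like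
    another interpolant \<open>X^t + p^m C\<close>, and \<open>Psi^(q^t) x\<close> agrees with
    \<open>Psi^j x\<close> modulo \<open>p^m Rx\<close>. The difference thus lies in every
    \<open>p^m Rx\<close> and vanishes by \<open>Rx_krull\<close>.\<close>
  have "poly_act P x - Psi j x = 0"
  proof (rule Rx_krull)
    show mem: "poly_act P x - Psi j x \<in> Rx x"
      by (intro Rx_diff Rx_poly_act Rx_Psi Rx_self P j)
    fix m
    show "\<exists>z\<in>Rx x. poly_act P x - Psi j x = sm (of_nat p ^ m) z"
    proof (cases m)
      \<comment> \<open>Separate because condition (c) speaks only of \<open>m >= 1\<close>.\<close>
      case 0
      then show ?thesis using mem by auto
    next
      case (Suc m')
      then have "m \<ge> 1" by simp
      then obtain e where e: "\<And>j j' y. j \<in> zloc_units p \<Longrightarrow> j' \<in> zloc_units p \<Longrightarrow>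
          (j - j') / of_nat (p ^ e) \<in> zloc p \<Longrightarrow> y \<in> Rx x \<Longrightarrow>
          \<exists>z\<in>Rx x. Psi j y - Psi j' y = sm (of_nat (p ^ m)) z"
        using bous(3)[of x] unfolding bous_c_def by metis
      obtain t C where C: "C \<in> zpoly" "(j - of_int q ^ t) / of_nat p ^ e \<in> zloc p"
          "\<And>k. k \<in> K \<Longrightarrow> poly (monom 1 t + smult (of_nat p ^ m) C) (of_int q powi k) = j powi k"
        using interp_unit_power[OF j K(1), where m = m and e = e] by metis
      obtain z where z: "z \<in> Rx x" "Psi j x - Psi (of_int q ^ t) x = sm (of_nat p ^ m) z"
        using e[OF j q_pow_unit[of t] _ Rx_self] C(2) by auto
      have "poly_act P x = poly_act (monom 1 t + smult (of_nat p ^ m) C) x"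
        by (rule poly_act_agree[OF K P(1)]) (use C P in auto)
      also have "\<dots> = Psi (of_int q ^ t) x + sm (of_nat p ^ m) (poly_act C x)"
        using C by (simp add: poly_act_add_left poly_act_monom poly_act_smult)
      finally have "poly_act P x - Psi j x = sm (of_nat p ^ m) (poly_act C x - z)"
        using z(2) by (simp add: s_diff algebra_simps)
      then show ?thesis using Rx_diff[OF Rx_poly_act[OF Rx_self C(1)] z(1)] by blast
    qed
  qed
  then show thesis using that P by simp
qed

text \<open>Peels off one group element at a time. \<open>S\<close> may exceed the support; the
  surplus terms have coefficient 0.\<close>

lemma act_eq_sum:
  assumes "finite S" "r \<in> grp_ring p" "\<And>j. r j \<noteq> 0 \<Longrightarrow> j \<in> S"
  shows "actR r x = (\<Sum>j\<in>S. sm (r j) (Psi j x))"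
  using assms
proof (induction S arbitrary: r rule: finite_induct)
  case empty
  then have "r = gr_const 0" by (auto simp: gr_const_def)
  then show ?case using s_0[of x] by (simp add: zsmul_def)
next
  case (insert j S)
  show ?case
  proof (cases "r j = 0")
    case True
    have "actR r x = (\<Sum>j\<in>S. sm (r j) (Psi j x))"
      using insert.prems True by (intro insert.IH) auto
    then show ?thesis using insert.hyps True by simp
  next
    case False
    then have j: "j \<in> zloc_units p" "r j \<in> zloc p" using insert.prems by (auto simp: grp_ring_def)
    define r' where "r' = r(j := 0)"
    have r': "r' \<in> grp_ring p"
    proof -
      have "finite {i. r' i \<noteq> 0}"
        by (rule finite_subset[of _ "{i. r i \<noteq> 0}"])
          (use insert.prems in \<open>auto simp: r'_def grp_ring_def\<close>)
      then show ?thesis using insert.prems by (auto simp: r'_def grp_ring_def)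
    qed
    have "r = gr_add (gr_mult (gr_const (r j)) (gr_Psi j)) r'"
      unfolding gr_const_mult by (auto simp: gr_add_def gr_Psi_def r'_def)
    then have "actR r x = actR (gr_mult (gr_const (r j)) (gr_Psi j)) x + actR r' x"
      using act_gr_add[OF gr_const_mult_in[OF j(2) gr_Psi_in[OF j(1)]] r', of x] by simp
    also have "actR (gr_mult (gr_const (r j)) (gr_Psi j)) x = sm (r j) (Psi j x)"
      using j by (simp add: act_gr_mult zsmul_def)
    also have "actR r' x = (\<Sum>i\<in>S. sm (r' i) (Psi i x))"
    proof (rule insert.IH[OF r'])
      fix i assume "r' i \<noteq> 0"
      then show "i \<in> S" using insert.prems(2)[of i] by (auto simp: r'_def split: if_splits)
    qed
    also have "\<dots> = (\<Sum>i\<in>S. sm (r i) (Psi i x))"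
      using insert.hyps by (intro sum.cong) (auto simp: r'_def)
    finally show ?thesis using insert.hyps by simp
  qed
qed

lemma R_to_A_eq_sum:
  assumes "finite S" "\<And>j. r j \<noteq> 0 \<Longrightarrow> j \<in> S"
  shows "R_to_A r k = (\<Sum>j\<in>S. r j * j powi k)"
  unfolding R_to_A_def by (rule sum.mono_neutral_left) (use assms in auto)

text \<open>Interpolating \<open>k \<mapsto> j^k\<close> for each \<open>j\<close> in the support
  and combining with the coefficients \<open>r j\<close> gives a polynomial that both interpolates
  \<open>R_to_A r\<close> and acts on \<open>x\<close> as \<open>r\<close> does.\<close>

lemma actA_R_to_A:
  assumes r: "r \<in> grp_ring p" shows "actA (R_to_A r) x = actR r x"
proof -
  define S where "S = {j. r j \<noteq> 0}"
  have S: "finite S" "S \<subseteq> zloc_units p" and rz: "\<And>j. r j \<in> zloc p"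
    using r by (auto simp: S_def grp_ring_def)
  have ex: "\<exists>Q. (\<forall>j\<in>S. Q j \<in> zpoly \<and> (\<forall>k\<in>K. poly (Q j) (of_int q powi k) = j powi k) \<and> poly_act (Q j) y = Psi j y)"
    if K: "finite K" "poly_act (vanish_poly K) y = 0" for K y
  proof (rule bchoice, rule ballI)
    fix j assume "j \<in> S"
    then have "j \<in> zloc_units p" using S by blast
    then show "\<exists>P. P \<in> zpoly \<and> (\<forall>k\<in>K. poly P (of_int q powi k) = j powi k) \<and> poly_act P y = Psi j y"
      using poly_act_interp_unit_power[OF _ K] by metis
  qed
  have interpolable: "interpolable (R_to_A r)"
    unfolding interpolable_def
  proof (intro allI impI)
    fix K :: "int set" assume K: "finite K"
    \<comment> \<open>The zero element is killed by the product over any \<open>K\<close>, so taking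
      \<open>y = 0\<close> extracts the bare interpolation statement.\<close>
    obtain Q where Q: "\<And>j. j \<in> S \<Longrightarrow> Q j \<in> zpoly \<and> (\<forall>k\<in>K. poly (Q j) (of_int q powi k) = j powi k)"
      using ex[OF K, of 0] by auto
    have "(\<Sum>j\<in>S. smult (r j) (Q j)) \<in> zpoly" using Q rz by (intro zpoly_sum) auto
    moreover have "poly (\<Sum>j\<in>S. smult (r j) (Q j)) (of_int q powi k) = R_to_A r k" if "k \<in> K" for k
      using that Q by (simp add: poly_sum R_to_A_def S_def[symmetric])
    ultimately show "\<exists>P\<in>zpoly. \<forall>k\<in>K. poly P (of_int q powi k) = R_to_A r k" by blast
  qed
  obtain K where K: "finite K" "poly_act (vanish_poly K) x = 0" using vanish_poly_kills by blast
  obtain Q where Q: "\<And>j. j \<in> S \<Longrightarrow> Q j \<in> zpoly"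
      "\<And>j k. j \<in> S \<Longrightarrow> k \<in> K \<Longrightarrow> poly (Q j) (of_int q powi k) = j powi k"
      "\<And>j. j \<in> S \<Longrightarrow> poly_act (Q j) x = Psi j x"
    using ex[OF K] by metis
  have poly_act_sum_left: "poly_act (\<Sum>j\<in>I. smult (r j) (Q j)) x = (\<Sum>j\<in>I. sm (r j) (poly_act (Q j) x))" if "I \<subseteq> S" for I
    using finite_subset[OF that S(1)] that
  proof (induction I rule: finite_induct)
    case (insert i I)
    moreover have "(\<Sum>j\<in>I. smult (r j) (Q j)) \<in> zpoly" using Q rz insert.prems by (intro zpoly_sum) auto
    ultimately show ?case using Q(1) rz by (simp add: poly_act_add_left poly_act_smult)
  qed simp
  have "actA (R_to_A r) x = poly_act (\<Sum>j\<in>S. smult (r j) (Q j)) x"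
  proof (rule actA_eq[OF interpolable K])
    show "(\<Sum>j\<in>S. smult (r j) (Q j)) \<in> zpoly" using Q rz by (intro zpoly_sum) auto
    show "poly (\<Sum>j\<in>S. smult (r j) (Q j)) (of_int q powi k) = R_to_A r k" if "k \<in> K" for k
      using that Q by (simp add: poly_sum R_to_A_def S_def[symmetric])
  qed
  also have "\<dots> = (\<Sum>j\<in>S. sm (r j) (Psi j x))"
    using poly_act_sum_left Q(3) by simp
  also have "\<dots> = actR r x"
    using act_eq_sum[OF S(1) r] by (simp add: S_def)
  finally show ?thesis .
qed

section \<open>Polynomials in \<open>Psi^q\<close> inside \<open>R\<close>, and uniqueness of the
  extension\<close>

lemma zpoly_realised:
  assumes P: "P \<in> zpoly"
  obtains r where "r \<in> grp_ring p" "R_to_A r = (\<lambda>k. poly P (of_int q powi k))" "\<And>x. actR r x = poly_act P x"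
proof -
  define S where "S = (\<lambda>i. (of_int q :: rat) ^ i) ` {..degree P}"
  have qi: "(of_int q :: rat) ^ i = of_int q ^ i' \<longleftrightarrow> i = i'" for i i' :: nat
    using injD[OF q_inj_pow, of "int i" "int i'"] by auto
  have inj: "inj_on (\<lambda>i. (of_int q :: rat) ^ i) {..degree P}" by (simp add: inj_on_def qi)
  \<comment> \<open>The coefficients of \<open>P\<close> placed at the powers \<open>q^i\<close>;
    these are pairwise distinct, so at most one summand is nonzero.\<close>
  define r where "r j = (\<Sum>i\<le>degree P. if j = of_int q ^ i then coeff P i else 0)" for j :: rat
  have rq: "r (of_int q ^ i) = coeff P i" if "i \<le> degree P" for i
    using that by (simp add: r_def qi)
  have supp: "j \<in> S" if j: "r j \<noteq> 0" for j
  proof (rule ccontr)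
    assume "j \<notin> S"
    then have "r j = 0" unfolding r_def S_def by (intro sum.neutral) auto
    then show False using j by simp
  qed
  have S: "finite S" "S \<subseteq> zloc_units p" by (auto simp: S_def)
  have "r \<in> grp_ring p"
    unfolding grp_ring_def using supp S finite_subset[of "{j. r j \<noteq> 0}" S] zpolyD[OF P]
    by (auto simp: r_def intro!: zloc_sum)
  moreover have "R_to_A r = (\<lambda>k. poly P (of_int q powi k))"
  proof
    fix k
    have "R_to_A r k = (\<Sum>j\<in>S. r j * j powi k)" by (rule R_to_A_eq_sum[OF S(1) supp])
    also have "\<dots> = (\<Sum>i\<le>degree P. coeff P i * (of_int q powi k) ^ i)"
      unfolding S_def sum.reindex[OF inj]
      by (intro sum.cong) (auto simp: rq power_int_power power_int_power' mult.commute)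
    finally show "R_to_A r k = poly P (of_int q powi k)" by (simp add: poly_altdef)
  qed
  moreover have "actR r x = poly_act P x" for x
  proof -
    have "actR r x = (\<Sum>j\<in>S. sm (r j) (Psi j x))"
      by (rule act_eq_sum[OF S(1) \<open>r \<in> grp_ring p\<close> supp])
    also have "\<dots> = poly_act P x"
      unfolding poly_act_def S_def sum.reindex[OF inj] by (intro sum.cong) (auto simp: rq)
    finally show ?thesis .
  qed
  ultimately show thesis using that by blast
qed

text \<open>The series splits into a polynomial head and a tail: the head lies in \<open>R\<close>,
  where every extension is prescribed, and a discrete action kills a far enough tail.\<close>

lemma actA_unique:
  assumes disc: "discrete_A_module p q actA'"
    and ext: "\<And>r x. r \<in> grp_ring p \<Longrightarrow> actA' (R_to_A r) x = actR r x"
    and f: "f \<in> A_ring p q"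
  shows "actA' f x = actA f x"
proof -
  obtain n' where n': "\<And>f. f \<in> A_filt p q n' \<Longrightarrow> actA' f x = 0"
    using disc unfolding discrete_A_module_def by blast
  obtain K where K: "finite K" "poly_act (vanish_poly K) x = 0" using vanish_poly_kills by blast
  obtain N where N: "K \<subseteq> exponents N" using exponents_covers[OF K(1)] by blast
  \<comment> \<open>From \<open>n'\<close> on the competing action kills the tails at
    \<open>x\<close>; \<open>N\<close> ensures that the first \<open>n\<close> exponents form a
    killing set, so that the same head also computes \<open>actA f x\<close>.\<close>
  define n where "n = max n' N"
  have exponents: "K \<subseteq> exponents n" using N exponents_mono[of N n] by (auto simp: n_def)
  have kn: "poly_act (vanish_poly (exponents n)) x = 0" using vanish_poly_kills_mono[OF K(2) exponents] by simp
  obtain a where a: "\<And>m. a m \<in> zloc p" "f = Phi_sum q a"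
    using f unfolding A_ring_def A_filt_def by blast
  have pz: "partial_poly a n \<in> zpoly" by (rule partial_poly_zpoly) (rule a(1))
  obtain r where r: "r \<in> grp_ring p" "R_to_A r = (\<lambda>k. poly (partial_poly a n) (of_int q powi k))"
    "\<And>x. actR r x = poly_act (partial_poly a n) x"
    by (rule zpoly_realised[OF pz]) blast
  define g where "g = Phi_sum q (\<lambda>m. if m < n then a m else 0)"
  define h where "h = Phi_sum q (\<lambda>m. if m < n then 0 else a m)"
  have fgh: "f = (\<lambda>k. g k + h k)"
    unfolding a(2) g_def h_def Phi_sum_add[symmetric]
    by (rule arg_cong[where f = "Phi_sum q"]) auto
  have gh: "g \<in> A_ring p q" "h \<in> A_ring p q" "h \<in> A_filt p q n'"
    unfolding A_ring_def A_filt_def g_def h_def n_def using a(1) by (auto intro!: exI)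
  have "actA' f x = actA' g x + actA' h x"
    using disc gh unfolding fgh discrete_A_module_def A_module_def ring_action_def by blast
  also have "actA' h x = 0" using n' gh by blast
  also have "actA' g x = poly_act (partial_poly a n) x"
    using r(1,3) ext[OF r(1), of x] unfolding g_def Phi_sum_truncate r(2) by simp
  also have "poly_act (partial_poly a n) x = actA f x"
    by (rule actA_eq[OF interpolable_A_ring[OF f] finite_exponents kn pz, symmetric]) (simp add: a(2) poly_partial_poly)
  finally show ?thesis by simp
qed

end

theorem theorem4p4:
  fixes p :: nat and q :: int
    and actR :: "(rat \<Rightarrow> rat) \<Rightarrow> 'm::ab_group_add \<Rightarrow> 'm"
  assumes "prime p" and "odd p"
    and "residue_primroot (p ^ 2) (nat (q mod int (p ^ 2)))"
    and "bousfield_module p actR"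
  shows "\<exists>actA :: (int \<Rightarrow> rat) \<Rightarrow> 'm \<Rightarrow> 'm.
           discrete_A_module p q actA
         \<and> (\<forall>r\<in>grp_ring p. \<forall>x. actA (R_to_A r) x = actR r x)
         \<and> (\<forall>actA' :: (int \<Rightarrow> rat) \<Rightarrow> 'm \<Rightarrow> 'm.
              discrete_A_module p q actA' \<and> (\<forall>r\<in>grp_ring p. \<forall>x. actA' (R_to_A r) x = actR r x)
              \<longrightarrow> (\<forall>f\<in>A_ring p q. \<forall>x. actA' f x = actA f x))"
proof -
  interpret bousfield p q actR
    using assms by unfold_locales auto
  show ?thesis
  proof (intro exI[of _ actA] conjI allI impI ballI; (elim conjE)?)
    show "discrete_A_module p q actA" by (rule discrete_actA)
    show "actA (R_to_A r) x = actR r x" if "r \<in> grp_ring p" for r x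
      using that by (rule actA_R_to_A)
    show "actA' f x = actA f x"
      if "discrete_A_module p q actA'" "\<forall>r\<in>grp_ring p. \<forall>x. actA' (R_to_A r) x = actR r x"
        "f \<in> A_ring p q" for actA' f x
      using that by (intro actA_unique) auto
  qed
qed

end
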